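(* Let $\alpha\ge 1$ and $k$ be positive integers with $k>\frac{17\alpha+15}{8}$, and let $n=k\alpha$. Then for every $G\in\mathcal{G}_{n,\alpha}$ we have $\lambda(G)\ge\lambda(P_{n,\alpha})$, with equality if and only if $G$ is isomorphic to $P_{n,\alpha}$.
   Context: All graphs are finite and simple. For a graph $G$, $\lambda(G)$ denotes the spectral radius of its adjacency matrix. For integers $n\ge\alpha\ge1$, $\mathcal{G}_{n,\alpha}$ is the set of all connected graphs of order $n$ with independence number $\alpha$. For $n=k\alpha$ with $k\ge 2$, the clique path $P_{n,\alpha}$ is the graph whose vertex set is a disjoint union $V_1\cup\cdots\cup V_\alpha$ with $|V_i|=k$, where each $V_i$ induces a complete graph $K_k$; for each $i=1,\dots,\alpha-1$ there is exactly one edge between $V_i$ and $V_{i+1}$, say $a_ib_{i+1}$ with $a_i\in V_i$, $b_{i+1}\in V_{i+1}$, where $b_i\neq a_i$ for $2\le i\le\alpha-1$; there are no other edges between different $V_i$'s. (It is obtained from a path on $\alpha$ vertices by blowing up each vertex to a $K_k$, with $2\alpha-2$ cut vertices.) *)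

theory Defs
  imports "Jordan_Normal_Form.Spectral_Radius"
begin

definition simple_graph :: "nat \<Rightarrow> (nat \<Rightarrow> nat \<Rightarrow> bool) \<Rightarrow> bool" where
  "simple_graph n E \<longleftrightarrow> (\<forall>u v. E u v \<longrightarrow> u < n \<and> v < n \<and> u \<noteq> v \<and> E v u)"

definition connected_graph :: "nat \<Rightarrow> (nat \<Rightarrow> nat \<Rightarrow> bool) \<Rightarrow> bool" where
  "connected_graph n E \<longleftrightarrow> (\<forall>u<n. \<forall>v<n. E\<^sup>*\<^sup>* u v)"

definition independent_set :: "nat \<Rightarrow> (nat \<Rightarrow> nat \<Rightarrow> bool) \<Rightarrow> nat set \<Rightarrow> bool" where
  "independent_set n E S \<longleftrightarrow> S \<subseteq> {0..<n} \<and> (\<forall>u\<in>S. \<forall>v\<in>S. \<not> E u v)"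

definition independence_number :: "nat \<Rightarrow> (nat \<Rightarrow> nat \<Rightarrow> bool) \<Rightarrow> nat" where
  "independence_number n E = Max {card S | S. independent_set n E S}"

definition adjacency_matrix :: "nat \<Rightarrow> (nat \<Rightarrow> nat \<Rightarrow> bool) \<Rightarrow> complex mat" where
  "adjacency_matrix n E = mat n n (\<lambda>(i, j). if E i j then 1 else 0)"

definition graph_spectral_radius :: "nat \<Rightarrow> (nat \<Rightarrow> nat \<Rightarrow> bool) \<Rightarrow> real" where
  "graph_spectral_radius n E = spectral_radius (adjacency_matrix n E)"

definition graph_iso :: "nat \<Rightarrow> (nat \<Rightarrow> nat \<Rightarrow> bool) \<Rightarrow> (nat \<Rightarrow> nat \<Rightarrow> bool) \<Rightarrow> bool" where
  "graph_iso n E F \<longleftrightarrow> (\<exists>f. bij_betw f {0..<n} {0..<n} \<and>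
      (\<forall>u<n. \<forall>v<n. E u v \<longleftrightarrow> F (f u) (f v)))"

text \<open>Clique path P_{n,alpha} with n = k*alpha: block V_i = {i*k ..< (i+1)*k} (i < alpha)
  is a clique; the unique edge between V_i and V_{i+1} joins a_i = (i+1)*k - 1 (last vertex
  of V_i) and b_{i+1} = (i+1)*k (first vertex of V_{i+1}); since k >= 2, b_i \<noteq> a_i.\<close>
definition clique_path :: "nat \<Rightarrow> nat \<Rightarrow> nat \<Rightarrow> nat \<Rightarrow> bool" where
  "clique_path k \<alpha> u v \<longleftrightarrow> u < k * \<alpha> \<and> v < k * \<alpha> \<and> u \<noteq> v \<and>
     (u div k = v div k \<or> (v = u + 1 \<and> v mod k = 0) \<or> (u = v + 1 \<and> u mod k = 0))"

end

theory Submission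
  imports Defs "HOL-Analysis.Function_Topology"
begin

text \<open>
  Write \<open>t = \<lambda>(P) + 1\<close> and \<open>\<mu> = (t - k)(t\<^sup>2 - 1)\<close>. Summing a Perron vector of the clique path
  over the blocks turns the eigenvalue equation into \<open>M s = \<mu> s\<close>, where
  \<open>(M s)\<^sub>i = \<Sum>\<^sub>j (s\<^sub>i + t s\<^sub>j)\<close>, the sum ranging over the neighbours \<open>j\<close> of \<open>i\<close> on the path.

  Suppose \<open>\<lambda>(G) \<le> \<lambda>(P)\<close>. The average degree of \<open>G\<close> is at most \<open>\<lambda>(P)\<close>, so \<open>G\<close> has at most about
  \<open>\<alpha>\<close> edges more than \<open>\<alpha>\<close> disjoint copies of \<open>K\<^sub>k\<close>. By the greedy proof of Turan's theorem the
  vertices split into \<open>\<alpha>\<close> classes with so few edges between them that each class has a vertex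
  without neighbours in other classes; a missing edge inside a class would then give an
  independent set of size \<open>\<alpha> + 1\<close>. So the classes are cliques, and they all have size \<open>k\<close> because
  \<open>\<lambda>(P) < k\<close>.

  Conversely, a nonnegative \<open>s\<close> with \<open>M s \<ge> \<mu> s\<close> for the quotient graph of \<open>G\<close> lifts to a vector
  \<open>x\<close> with \<open>A x \<ge> (t - 1) x\<close>. To compare an arbitrary connected quotient with the path,
  list the entries of \<open>s\<close> on the path in decreasing order, so that consecutive neighbours are
  \<open>j - 2\<close> and \<open>j\<close>. Every connected graph has an ordering in which each vertex has a neighbour at
  least two places earlier, so assigning the entries of \<open>s\<close> in this order does not decrease the
  quadratic form of \<open>M\<close>. Strictness for a quotient other than the path comes from a small
  perturbation of \<open>s\<close>, since its first-order effect vanishes on the path.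
\<close>

section \<open>Spectral radius and Rayleigh quotients\<close>

definition quadratic_form :: "nat \<Rightarrow> (nat \<Rightarrow> nat \<Rightarrow> real) \<Rightarrow> (nat \<Rightarrow> real) \<Rightarrow> real" where
  "quadratic_form m B x = (\<Sum>i<m. \<Sum>j<m. B i j * x i * x j)"

definition sq_norm_upto :: "nat \<Rightarrow> (nat \<Rightarrow> real) \<Rightarrow> real" where
  "sq_norm_upto m x = (\<Sum>i<m. (x i)\<^sup>2)"

lemma sq_norm_upto_nonneg: "sq_norm_upto m x \<ge> 0"
  by (simp add: sq_norm_upto_def sum_nonneg)

lemma sq_norm_upto_eq_0_iff: "sq_norm_upto m x = 0 \<longleftrightarrow> (\<forall>i<m. x i = 0)"
  by (auto simp: sq_norm_upto_def sum_nonneg_eq_0_iff)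

lemma sq_norm_upto_pos:
  assumes "i < m" "x i \<noteq> 0"
  shows "sq_norm_upto m x > 0"
  using assms sq_norm_upto_nonneg[of m x] sq_norm_upto_eq_0_iff[of m x] by fastforce

lemma quadratic_form_add:
  assumes "\<And>i j. i < m \<Longrightarrow> j < m \<Longrightarrow> B i j = B j i"
  shows "quadratic_form m B (\<lambda>i. x i + d * y i) =
    quadratic_form m B x + 2 * d * (\<Sum>i<m. y i * (\<Sum>j<m. B i j * x j)) + d\<^sup>2 * quadratic_form m B y"
proof -
  have sw: "(\<Sum>i<m. \<Sum>j<m. B i j * x i * y j) = (\<Sum>i<m. \<Sum>j<m. B i j * y i * x j)"
    by (subst sum.swap) (intro sum.cong refl, use assms in \<open>simp add: mult_ac\<close>)
  have "quadratic_form m B (\<lambda>i. x i + d * y i) =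
      (\<Sum>i<m. \<Sum>j<m. B i j * x i * x j + d * (B i j * x i * y j) + d * (B i j * y i * x j) + d\<^sup>2 * (B i j * y i * y j))"
    unfolding quadratic_form_def by (intro sum.cong refl) (simp add: algebra_simps power2_eq_square)
  also have "\<dots> = quadratic_form m B x + d * (\<Sum>i<m. \<Sum>j<m. B i j * x i * y j)
      + d * (\<Sum>i<m. \<Sum>j<m. B i j * y i * x j) + d\<^sup>2 * quadratic_form m B y"
    by (simp add: quadratic_form_def sum.distrib sum_distrib_left)
  also have "\<dots> = quadratic_form m B x + 2 * d * (\<Sum>i<m. \<Sum>j<m. B i j * y i * x j) + d\<^sup>2 * quadratic_form m B y"
    unfolding sw by simp
  finally show ?thesis by (simp add: sum_distrib_left mult_ac)
qed

lemma sq_norm_upto_add: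
  "sq_norm_upto m (\<lambda>i. x i + d * y i) = sq_norm_upto m x + 2 * d * (\<Sum>i<m. y i * x i) + d\<^sup>2 * sq_norm_upto m y"
  by (simp add: sq_norm_upto_def sum.distrib sum_distrib_left power2_sum power_mult_distrib algebra_simps)

text \<open>A quadratic in \<open>d\<close> that vanishes at 0 and is never negative has its minimum
  there, so its derivative at 0 is zero. This serves as the first-order condition at a maximum of
  the Rayleigh quotient.\<close>

lemma linear_part_zero:
  fixes b c :: real
  assumes "\<And>d. 2 * d * b + d\<^sup>2 * c \<ge> 0"
  shows "b = 0"
proof (rule ccontr)
  assume b: "b \<noteq> 0"
  define e where "e = \<bar>c\<bar> + 1"
  have e: "e > 0" "c < e" by (auto simp: e_def)
  \<comment> \<open>Since \<open>c < e\<close>, the value \<open>d = - b / e\<close> lets the linear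
    term outweigh the quadratic one.\<close>
  have "2 * (- b / e) * b + (- b / e)\<^sup>2 * c \<ge> 0" by (rule assms)
  also have "2 * (- b / e) * b + (- b / e)\<^sup>2 * c = b\<^sup>2 / e * (c / e - 2)"
    using e by (simp add: field_simps power2_eq_square)
  finally have "b\<^sup>2 / e * (c / e - 2) \<ge> 0" .
  moreover have "b\<^sup>2 / e > 0" using b e by simp
  moreover have "c / e - 2 < 0" using e by (simp add: field_simps)
  ultimately show False using mult_pos_neg[of "b\<^sup>2 / e" "c / e - 2"] by linarith
qed

text \<open>Maximise the form over the unit sphere. As \<open>B\<close> is nonnegative, taking
  absolute values keeps a maximiser maximal, and the vanishing first variation is the eigenvalue
  equation.\<close>

theorem symmetric_nonneg_top_eigenvector:
  assumes m: "m > 0"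
    and sym: "\<And>i j. i < m \<Longrightarrow> j < m \<Longrightarrow> B i j = B j i"
    and nonneg: "\<And>i j. i < m \<Longrightarrow> j < m \<Longrightarrow> B i j \<ge> 0"
  obtains r x where "\<And>i. x i \<ge> 0" and "\<exists>i<m. x i > 0"
    and "\<And>i. i < m \<Longrightarrow> (\<Sum>j<m. B i j * x j) = r * x i"
    and "\<And>y. quadratic_form m B y \<le> r * sq_norm_upto m y"
proof -
  \<comment> \<open>Vectors are functions on all of \<open>nat\<close>; pinning the coordinates from
    \<open>m\<close> on to 0 makes the sphere a closed part of a product of compact sets.\<close>
  define box where "box = PiE UNIV (\<lambda>i::nat. if i < m then {-1..1::real} else {0})"
  define K where "K = box \<inter> {x. sq_norm_upto m x = 1}"
  have "compact box"
    unfolding box_def compactin_euclidean_iff[symmetric] euclidean_product_topology[symmetric]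
    by (subst compactin_PiE) auto
  moreover have "closed {x. sq_norm_upto m x = 1}"
    unfolding sq_norm_upto_def
    by (intro closed_Collect_eq continuous_intros)
       (auto intro!: continuous_intros continuous_on_product_coordinates)
  ultimately have cK: "compact K" unfolding K_def by (rule compact_Int_closed)
  have "(\<lambda>i. if i = 0 then 1 else 0) \<in> K"
    using m by (auto simp: K_def box_def sq_norm_upto_def if_distrib[of "\<lambda>x. x^2"] cong: if_cong)
  then have neK: "K \<noteq> {}" by blast
  have "continuous_on K (quadratic_form m B)"
    unfolding quadratic_form_def[abs_def]
    by (intro continuous_intros continuous_on_subset[OF continuous_on_product_coordinates]) auto
  then obtain z where z: "z \<in> K" and zmax: "\<And>y. y \<in> K \<Longrightarrow> quadratic_form m B y \<le> quadratic_form m B z"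
    using continuous_attains_sup[OF cK neK] by blast
  define r where "r = quadratic_form m B z"
  define x where "x i = \<bar>z i\<bar>" for i
  have Rr: "quadratic_form m B y \<le> r * sq_norm_upto m y" for y
  proof (cases "sq_norm_upto m y = 0")
    case True
    then have "\<forall>i<m. y i = 0" by (simp add: sq_norm_upto_eq_0_iff)
    then show ?thesis using True by (simp add: quadratic_form_def)
  next
    case False
    define s where "s = sqrt (sq_norm_upto m y)"
    have s: "s > 0" "s\<^sup>2 = sq_norm_upto m y" using False sq_norm_upto_nonneg[of m y] by (auto simp: s_def)
    define w where "w i = (if i < m then y i / s else 0)" for i
    have "sq_norm_upto m w = sq_norm_upto m y / s\<^sup>2"
      by (simp add: sq_norm_upto_def w_def power_divide sum_divide_distrib)
    then have nw: "sq_norm_upto m w = 1" using s False by simp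
    have "(w i)\<^sup>2 \<le> 1" if "i < m" for i
      using member_le_sum[of i "{..<m}" "\<lambda>i. (w i)\<^sup>2"] that nw by (simp add: sq_norm_upto_def)
    then have "\<bar>w i\<bar> \<le> 1" if "i < m" for i using that abs_square_le_1 by blast
    then have "w i \<in> {-1..1}" if "i < m" for i by (metis abs_le_iff atLeastAtMost_iff minus_le_iff that)
    moreover have "w i = 0" if "\<not> i < m" for i using that by (simp add: w_def)
    ultimately have "w \<in> K" using nw by (auto simp: K_def box_def PiE_def)
    then have "quadratic_form m B w \<le> r" using zmax r_def by simp
    moreover have "quadratic_form m B w = quadratic_form m B y / s\<^sup>2"
      unfolding quadratic_form_def sum_divide_distrib
      by (intro sum.cong refl) (simp add: w_def power2_eq_square)
    ultimately show ?thesis using zero_less_power[OF s(1), of 2] unfolding s(2) by (simp add: pos_divide_le_eq mult.commute)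
  qed
  have nz: "sq_norm_upto m z = 1" using z by (simp add: K_def)
  then have nx: "sq_norm_upto m x = 1" by (simp add: sq_norm_upto_def x_def)
  have "quadratic_form m B z \<le> quadratic_form m B x"
    unfolding quadratic_form_def x_def
    by (intro sum_mono) (use nonneg in \<open>auto simp: abs_mult[symmetric] mult.assoc intro!: mult_left_mono\<close>)
  then have Qx: "quadratic_form m B x = r" using Rr[of x] nx r_def by simp
  have "(\<Sum>j<m. B i j * x j) = r * x i" if "i < m" for i
  proof -
    \<comment> \<open>Varying the maximiser along the unit vector at \<open>i\<close> isolates row
      \<open>i\<close> of the eigenvalue equation.\<close>
    define y where "y j = (if j = i then 1 else 0::real)" for j
    have "r * x i - (\<Sum>j<m. B i j * x j) = 0"
    proof (rule linear_part_zero)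
      fix d
      have s1: "(\<Sum>i<m. y i * f i) = f i" for f :: "nat \<Rightarrow> real"
        using that by (simp add: y_def if_distrib[of "\<lambda>c. c * _"] cong: if_cong)
      have "quadratic_form m B (\<lambda>i. x i + d * y i) \<le> r * sq_norm_upto m (\<lambda>i. x i + d * y i)" by (rule Rr)
      moreover have "quadratic_form m B (\<lambda>i. x i + d * y i) =
          r + 2 * d * (\<Sum>j<m. B i j * x j) + d\<^sup>2 * quadratic_form m B y"
        using quadratic_form_add[of m B x d y] sym by (simp only: s1 Qx)
      ultimately show "0 \<le> 2 * d * (r * x i - (\<Sum>j<m. B i j * x j))
          + d\<^sup>2 * (r * sq_norm_upto m y - quadratic_form m B y)"
        by (simp only: sq_norm_upto_add s1 nx) (simp add: algebra_simps)
    qed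
    then show ?thesis by simp
  qed
  moreover have "\<exists>i<m. x i > 0"
  proof (rule ccontr)
    assume "\<not> ?thesis"
    then have "\<forall>i<m. x i = 0" by (auto simp: x_def)
    then show False using nx sq_norm_upto_eq_0_iff[of m x] by simp
  qed
  ultimately show thesis using Rr by (intro that[of x r]) (auto simp: x_def)
qed

lemma quadratic_form_ge_of_subsolution:
  assumes "\<And>i. i < m \<Longrightarrow> x i \<ge> 0"
    and "\<And>i. i < m \<Longrightarrow> (\<Sum>j<m. B i j * x j) \<ge> c * x i"
  shows "quadratic_form m B x \<ge> c * sq_norm_upto m x"
proof -
  have "quadratic_form m B x = (\<Sum>i<m. x i * (\<Sum>j<m. B i j * x j))"
    by (simp add: quadratic_form_def sum_distrib_left mult_ac)
  also have "\<dots> \<ge> (\<Sum>i<m. x i * (c * x i))"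
    using assms by (intro sum_mono mult_left_mono) auto
  finally show ?thesis by (simp add: sq_norm_upto_def sum_distrib_left power2_eq_square mult_ac)
qed

text \<open>Pairing with \<open>x\<close> weights row \<open>i0\<close> by \<open>x i0 > 0\<close>,
  so a single strict row at a positive entry makes the whole form strictly larger.\<close>

lemma quadratic_form_gt_of_subsolution:
  assumes "\<And>i. i < m \<Longrightarrow> x i \<ge> 0"
    and "\<And>i. i < m \<Longrightarrow> (\<Sum>j<m. B i j * x j) \<ge> c * x i"
    and "i0 < m" "x i0 > 0" "(\<Sum>j<m. B i0 j * x j) > c * x i0"
  shows "quadratic_form m B x > c * sq_norm_upto m x"
proof -
  have "quadratic_form m B x = (\<Sum>i<m. x i * (\<Sum>j<m. B i j * x j))"
    by (simp add: quadratic_form_def sum_distrib_left mult_ac)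
  also have "\<dots> > (\<Sum>i<m. x i * (c * x i))"
  proof (rule sum_strict_mono_ex1)
    show "\<forall>i\<in>{..<m}. x i * (c * x i) \<le> x i * (\<Sum>j<m. B i j * x j)"
      using assms by (auto intro!: mult_left_mono)
    show "\<exists>i\<in>{..<m}. x i * (c * x i) < x i * (\<Sum>j<m. B i j * x j)"
      using assms(3,4) mult_strict_left_mono[OF assms(5,4)] by blast
  qed simp
  finally show ?thesis by (simp add: sq_norm_upto_def sum_distrib_left power2_eq_square mult_ac)
qed

section \<open>Spectral radius of a graph through real Rayleigh quotients\<close>

definition adj :: "(nat \<Rightarrow> nat \<Rightarrow> bool) \<Rightarrow> nat \<Rightarrow> nat \<Rightarrow> real" where
  "adj E i j = (if E i j then 1 else 0)"

lemma sum_adj: "(\<Sum>j<n. adj E i j * x j) = (\<Sum>j\<in>{j. j < n \<and> E i j}. x j)"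
proof -
  have "(\<Sum>j<n. adj E i j * x j) = (\<Sum>j<n. if E i j then x j else 0)"
    by (intro sum.cong) (auto simp: adj_def)
  also have "\<dots> = (\<Sum>j\<in>{j. j < n \<and> E i j}. x j)"
    by (subst sum.inter_filter[symmetric]) (auto intro!: sum.cong)
  finally show ?thesis .
qed

lemma adjacency_matrix_eigenvector_iff:
  assumes "v \<in> carrier_vec n"
  shows "adjacency_matrix n E *\<^sub>v v = z \<cdot>\<^sub>v v \<longleftrightarrow>
    (\<forall>i<n. (\<Sum>j<n. complex_of_real (adj E i j) * vec_index v j) = z * vec_index v i)"
proof -
  have "vec_index (adjacency_matrix n E *\<^sub>v v) i = (\<Sum>j<n. complex_of_real (adj E i j) * vec_index v j)"
    if "i < n" for i
    using that assms
    by (auto simp: adjacency_matrix_def adj_def scalar_prod_def atLeast0LessThan intro!: sum.cong)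
  then show ?thesis
    using assms by (auto simp: vec_eq_iff adjacency_matrix_def)
qed

text \<open>The vector \<open>x\<close> makes \<open>r\<close> an eigenvalue. Conversely, by the
  triangle inequality the moduli \<open>y\<close> of an eigenvector for a complex eigenvalue
  \<open>z\<close> satisfy \<open>A y \<ge> cmod z * y\<close>, and the Rayleigh bound gives
  \<open>cmod z \<le> r\<close>.\<close>

lemma graph_spectral_radius_eqI:
  assumes n: "n > 0" and x: "\<And>i. i < n \<Longrightarrow> x i \<ge> 0" "\<exists>i<n. x i > 0"
    and eig: "\<And>i. i < n \<Longrightarrow> (\<Sum>j<n. adj E i j * x j) = r * x i"
    and bd: "\<And>y. quadratic_form n (adj E) y \<le> r * sq_norm_upto n y"
  shows "graph_spectral_radius n E = r"
proof -
  have car: "adjacency_matrix n E \<in> carrier_mat n n" by (simp add: adjacency_matrix_def)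
  obtain i0 where i0: "i0 < n" "x i0 > 0" using x by blast
  \<comment> \<open>The spectral radius measures moduli, so \<open>r\<close> has to be identified
    with its own modulus.\<close>
  have "r * x i0 \<ge> 0" unfolding eig[OF i0(1), symmetric]
    using x by (intro sum_nonneg) (auto simp: adj_def)
  then have r0: "r \<ge> 0" using i0 by (simp add: zero_le_mult_iff)
  define v where "v = vec n (\<lambda>i. complex_of_real (x i))"
  have v: "v \<in> carrier_vec n" by (simp add: v_def)
  have "v \<noteq> 0\<^sub>v n" using i0 by (auto simp: v_def vec_eq_iff)
  moreover have "adjacency_matrix n E *\<^sub>v v = complex_of_real r \<cdot>\<^sub>v v"
    unfolding adjacency_matrix_eigenvector_iff[OF v]
  proof (intro allI impI)
    fix i assume i: "i < n"
    have "(\<Sum>j<n. complex_of_real (adj E i j) * vec_index v j) = complex_of_real (\<Sum>j<n. adj E i j * x j)"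
      by (simp add: v_def)
    then show "(\<Sum>j<n. complex_of_real (adj E i j) * vec_index v j) = complex_of_real r * vec_index v i"
      using eig[OF i] i by (simp add: v_def)
  qed
  ultimately have "complex_of_real r \<in> spectrum (adjacency_matrix n E)"
    using v car by (auto simp: spectrum_def eigenvalue_def eigenvector_def)
  then have ge: "r \<le> graph_spectral_radius n E"
    unfolding graph_spectral_radius_def using r0
    by (intro spectral_radius_mem_max(2)[OF car n]) (auto intro!: image_eqI[of _ _ "complex_of_real r"])
  obtain z where z: "z \<in> spectrum (adjacency_matrix n E)" "graph_spectral_radius n E = cmod z"
    using spectral_radius_mem_max(1)[OF car n] by (auto simp: graph_spectral_radius_def)
  then obtain w where w: "w \<in> carrier_vec n" "w \<noteq> 0\<^sub>v n"
    and ew: "adjacency_matrix n E *\<^sub>v w = z \<cdot>\<^sub>v w"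
    using car by (auto simp: spectrum_def eigenvalue_def eigenvector_def)
  define y where "y i = cmod (vec_index w i)" for i
  have "cmod z * sq_norm_upto n y \<le> quadratic_form n (adj E) y"
  proof (rule quadratic_form_ge_of_subsolution)
    fix i assume i: "i < n"
    have "cmod z * y i = cmod (\<Sum>j<n. complex_of_real (adj E i j) * vec_index w j)"
      using ew[unfolded adjacency_matrix_eigenvector_iff[OF w(1)]] i by (simp add: y_def norm_mult)
    also have "\<dots> \<le> (\<Sum>j<n. cmod (complex_of_real (adj E i j) * vec_index w j))" by (rule norm_sum)
    also have "\<dots> = (\<Sum>j<n. adj E i j * y j)"
      by (intro sum.cong refl) (auto simp: norm_mult y_def adj_def)
    finally show "cmod z * y i \<le> (\<Sum>j<n. adj E i j * y j)" .
  qed (simp add: y_def)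
  also have "\<dots> \<le> r * sq_norm_upto n y" by (rule bd)
  finally have "cmod z * sq_norm_upto n y \<le> r * sq_norm_upto n y" .
  moreover have "sq_norm_upto n y > 0"
  proof -
    obtain i where "i < n" "vec_index w i \<noteq> 0" using w by (auto simp: vec_eq_iff)
    then show ?thesis by (intro sq_norm_upto_pos[of i]) (auto simp: y_def)
  qed
  ultimately have "cmod z \<le> r" by simp
  then show ?thesis using ge z by simp
qed

lemma graph_perron:
  assumes n: "n > 0" and G: "simple_graph n E"
  obtains x where "\<And>i. x i \<ge> 0" "\<exists>i<n. x i > 0"
    "\<And>i. i < n \<Longrightarrow> (\<Sum>j<n. adj E i j * x j) = graph_spectral_radius n E * x i"
    "\<And>y. quadratic_form n (adj E) y \<le> graph_spectral_radius n E * sq_norm_upto n y"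
proof -
  obtain r x where *: "\<And>i. x i \<ge> 0" "\<exists>i<n. x i > 0"
    "\<And>i. i < n \<Longrightarrow> (\<Sum>j<n. adj E i j * x j) = r * x i"
    "\<And>y. quadratic_form n (adj E) y \<le> r * sq_norm_upto n y"
    using symmetric_nonneg_top_eigenvector[OF n, of "adj E"] G
    unfolding adj_def simple_graph_def by (smt (verit))
  then have "graph_spectral_radius n E = r" by (intro graph_spectral_radius_eqI[OF n, of x]) auto
  then show thesis using * that by blast
qed

lemma graph_spectral_radius_ge_Rayleigh:
  assumes "n > 0" "simple_graph n E"
  shows "quadratic_form n (adj E) y \<le> graph_spectral_radius n E * sq_norm_upto n y"
  using graph_perron[OF assms] by metis

lemma graph_spectral_radius_ge:
  assumes "n > 0" "simple_graph n E" and "\<And>i. i < n \<Longrightarrow> x i \<ge> 0"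
    and "\<And>i. i < n \<Longrightarrow> (\<Sum>j\<in>{j. j < n \<and> E i j}. x j) \<ge> c * x i" and "l < n" "x l > 0"
  shows "graph_spectral_radius n E \<ge> c"
proof -
  have "c * sq_norm_upto n x \<le> quadratic_form n (adj E) x"
    using assms by (intro quadratic_form_ge_of_subsolution) (auto simp: sum_adj)
  also have "\<dots> \<le> graph_spectral_radius n E * sq_norm_upto n x"
    by (rule graph_spectral_radius_ge_Rayleigh) fact+
  finally show ?thesis using sq_norm_upto_pos[of l n x] assms by simp
qed

lemma graph_spectral_radius_gt:
  assumes "n > 0" "simple_graph n E" and "\<And>i. i < n \<Longrightarrow> x i \<ge> 0"
    and "\<And>i. i < n \<Longrightarrow> (\<Sum>j\<in>{j. j < n \<and> E i j}. x j) \<ge> c * x i" and "l < n" "x l > 0"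
    and "(\<Sum>j\<in>{j. j < n \<and> E l j}. x j) > c * x l"
  shows "graph_spectral_radius n E > c"
proof -
  have "c * sq_norm_upto n x < quadratic_form n (adj E) x"
    using assms by (intro quadratic_form_gt_of_subsolution[of _ _ _ _ l]) (auto simp: sum_adj)
  also have "\<dots> \<le> graph_spectral_radius n E * sq_norm_upto n x"
    by (rule graph_spectral_radius_ge_Rayleigh) fact+
  finally show ?thesis using sq_norm_upto_pos[of l n x] assms by simp
qed

text \<open>The indicator of \<open>B\<close> is a test vector: a vertex of the clique sees the
  other \<open>card B - 1\<close> vertices, and elsewhere the indicator is zero.\<close>

lemma graph_spectral_radius_ge_clique:
  assumes G: "simple_graph n E" and B: "B \<subseteq> {..<n}" "B \<noteq> {}"
    and clique: "\<And>u v. u \<in> B \<Longrightarrow> v \<in> B \<Longrightarrow> u \<noteq> v \<Longrightarrow> E u v"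
  shows "graph_spectral_radius n E \<ge> real (card B) - 1"
proof -
  obtain l where l: "l \<in> B" "l < n" using B by auto
  have fin: "finite B" using B(1) by (rule finite_subset) simp
  show ?thesis
  proof (rule graph_spectral_radius_ge[OF _ G, where x = "indicator B" and l = l])
    fix i assume "i < n"
    show "(real (card B) - 1) * indicator B i \<le> (\<Sum>j | j < n \<and> E i j. indicator B j :: real)"
    proof (cases "i \<in> B")
      case True
      then have "card B > 0" using fin by (auto simp: card_gt_0_iff)
      then have "real (card B) - 1 = (\<Sum>j\<in>B - {i}. indicator B j :: real)"
        using True fin by simp
      also have "\<dots> \<le> (\<Sum>j | j < n \<and> E i j. indicator B j)"
        using B(1) clique[OF True] by (intro sum_mono2) auto
      finally show ?thesis using True by simp
    next
      case False
      then show ?thesis by (simp add: sum_nonneg)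
    qed
  qed (use l in auto)
qed

text \<open>The Perron vector of \<open>F\<close> is pulled back along \<open>f\<close>, and the
  Rayleigh bound is transported along the inverse \<open>g\<close>.\<close>

lemma graph_spectral_radius_iso:
  assumes n: "n > 0" and E: "simple_graph n E" and F: "simple_graph n F" and iso: "graph_iso n E F"
  shows "graph_spectral_radius n E = graph_spectral_radius n F"
proof -
  obtain f where f: "bij_betw f {..<n} {..<n}" "\<And>u v. u < n \<Longrightarrow> v < n \<Longrightarrow> E u v \<longleftrightarrow> F (f u) (f v)"
    using iso by (auto simp: graph_iso_def atLeast0LessThan)
  define g where "g = inv_into {..<n} f"
  have g: "g i < n" "f (g i) = i" if "i < n" for i
    using bij_betw_inv_into[OF f(1)] bij_betw_inv_into_right[OF f(1)] that
    by (auto simp: g_def bij_betw_def)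
  have gf: "g (f i) = i" if "i < n" for i using bij_betw_inv_into_left[OF f(1)] that by (simp add: g_def)
  have fn: "f i < n" if "i < n" for i using f(1) that by (auto simp: bij_betw_def)
  have re: "(\<Sum>i<n. h (f i)) = (\<Sum>i<n. h i)" for h :: "nat \<Rightarrow> real"
    by (rule sum.reindex_bij_betw[OF f(1)])
  obtain x where x: "\<And>i. x i \<ge> 0" "\<exists>i<n. x i > 0"
    "\<And>i. i < n \<Longrightarrow> (\<Sum>j<n. adj F i j * x j) = graph_spectral_radius n F * x i"
    "\<And>y. quadratic_form n (adj F) y \<le> graph_spectral_radius n F * sq_norm_upto n y"
    using graph_perron[OF n F] by metis
  have aEF: "adj E i j = adj F (f i) (f j)" if "i < n" "j < n" for i j using f that by (simp add: adj_def)
  show ?thesis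
  proof (rule graph_spectral_radius_eqI[OF n, where x = "x \<circ> f"])
    show "\<exists>i<n. 0 < (x \<circ> f) i" using x(2) g by (metis comp_apply)
    fix i assume i: "i < n"
    have "(\<Sum>j<n. adj E i j * (x \<circ> f) j) = (\<Sum>j<n. adj F (f i) (f j) * x (f j))"
      using i by (intro sum.cong) (auto simp: aEF)
    also have "\<dots> = graph_spectral_radius n F * (x \<circ> f) i"
      using re[of "\<lambda>j. adj F (f i) j * x j"] x(3)[OF fn[OF i]] by simp
    finally show "(\<Sum>j<n. adj E i j * (x \<circ> f) j) = graph_spectral_radius n F * (x \<circ> f) i" .
  next
    fix y
    have "quadratic_form n (adj E) y = (\<Sum>i<n. \<Sum>j<n. adj F (f i) (f j) * y (g (f i)) * y (g (f j)))"
      unfolding quadratic_form_def by (intro sum.cong refl) (auto simp: aEF gf)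
    also have "\<dots> = quadratic_form n (adj F) (y \<circ> g)"
      using re[of "\<lambda>i. \<Sum>j<n. adj F i (f j) * y (g i) * y (g (f j))"]
        re[of "\<lambda>j. adj F _ j * y (g _) * y (g j)"]
      by (simp add: quadratic_form_def)
    also have "\<dots> \<le> graph_spectral_radius n F * sq_norm_upto n (y \<circ> g)" by (rule x(4))
    also have "sq_norm_upto n (y \<circ> g) = (\<Sum>i<n. (y (g (f i)))\<^sup>2)"
      using re[of "\<lambda>i. (y (g i))\<^sup>2"] by (simp add: sq_norm_upto_def)
    also have "\<dots> = sq_norm_upto n y" unfolding sq_norm_upto_def by (intro sum.cong) (auto simp: gf)
    finally show "quadratic_form n (adj E) y \<le> graph_spectral_radius n F * sq_norm_upto n y" .
  qed (use x in auto)
qed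

section \<open>Spread orderings of connected graphs\<close>

text \<open>Connectivity by cuts instead of walks: this form is stable under growing a subset vertex
  by vertex.\<close>

definition cut_connected :: "'a set \<Rightarrow> ('a \<Rightarrow> 'a \<Rightarrow> bool) \<Rightarrow> bool" where
  "cut_connected W K \<longleftrightarrow> (\<forall>A\<subseteq>W. A \<noteq> {} \<longrightarrow> A \<noteq> W \<longrightarrow> (\<exists>a\<in>A. \<exists>b\<in>W - A. K a b))"

text \<open>A set that splits \<open>U\<close> already has a leaving edge inside \<open>U\<close>;
  otherwise it is \<open>{b}\<close> or \<open>U\<close>, and the edge between \<open>a\<close> and
  \<open>b\<close> leaves it.\<close>

lemma cut_connected_insert:
  assumes "cut_connected U K" "a \<in> U" "K a b" "K b a"
  shows "cut_connected (insert b U) K"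
  unfolding cut_connected_def
proof (intro allI impI)
  fix A assume A: "A \<subseteq> insert b U" "A \<noteq> {}" "A \<noteq> insert b U"
  show "\<exists>x\<in>A. \<exists>y\<in>insert b U - A. K x y"
  proof (cases "A \<inter> U = {} \<or> A \<inter> U = U")
    case True
    then have "A = {b} \<and> b \<notin> U \<or> A = U \<and> b \<notin> U" using A by blast
    then show ?thesis using assms by blast
  next
    case False
    then have "\<exists>x\<in>A \<inter> U. \<exists>y\<in>U - A \<inter> U. K x y"
      using assms(1) unfolding cut_connected_def by (metis inf_le2)
    then show ?thesis by blast
  qed
qed

text \<open>A largest connected proper subset containing \<open>p\<close> misses just one vertex,
  since an edge leaving it would otherwise allow an enlargement. Thus \<open>b\<close> is a non-cut
  vertex other than \<open>p\<close>.\<close>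

lemma cut_connected_remove_vertex:
  assumes fin: "finite W" and con: "cut_connected W K" and sym: "\<And>a b. K a b \<Longrightarrow> K b a"
    and p: "p \<in> W" and W: "W \<noteq> {p}"
  obtains U a b where "W = insert b U" "b \<notin> U" "p \<in> U" "cut_connected U K" "a \<in> U" "K a b"
proof -
  define P where "P U \<longleftrightarrow> p \<in> U \<and> U \<subset> W \<and> cut_connected U K" for U
  have "P {p}" using p W by (auto simp: P_def cut_connected_def)
  moreover have "\<forall>U. P U \<longrightarrow> card U < card W"
    using fin by (auto simp: P_def intro!: psubset_card_mono)
  ultimately obtain U where U: "P U" and max: "\<And>U'. P U' \<Longrightarrow> card U' \<le> card U"
    using ex_has_greatest_nat[of P "{p}" card "card W"] by metis
  then obtain a b where ab: "a \<in> U" "b \<in> W - U" "K a b"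
    using con unfolding P_def cut_connected_def by (metis emptyE psubset_eq)
  have "insert b U = W"
  proof (rule ccontr)
    assume "insert b U \<noteq> W"
    then have "P (insert b U)" using U ab cut_connected_insert[of U K a b] sym by (auto simp: P_def)
    moreover have "card (insert b U) = Suc (card U)"
      using ab U fin by (intro card_insert_disjoint) (auto simp: P_def intro: finite_subset)
    ultimately show False using max by fastforce
  qed
  then show thesis using that[of b U a] ab U by (auto simp: P_def)
qed

text \<open>Every vertex attaches to one that precedes it by at least two places (truncated
  subtraction lets the first two vertices attach to the head). Demanding that the last vertex
  avoids a prescribed \<open>p\<close> is what makes the induction go through.\<close>
lemma spread_ordering_aux:
  assumes "finite W" "cut_connected W K" and sym: "\<And>a b. K a b \<Longrightarrow> K b a" and "p \<in> W" "W \<noteq> {p}"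
  shows "\<exists>xs. distinct xs \<and> set xs = W \<and> last xs \<noteq> p \<and>
    (\<forall>j<length xs. 0 < j \<longrightarrow> (\<exists>i\<le>j - 2. K (xs ! i) (xs ! j)))"
  using assms(1,2,4,5)
proof (induction "card W" arbitrary: W p rule: less_induct)
  case less
  obtain U a b where W: "W = insert b U" and b: "b \<notin> U" and U: "p \<in> U" "cut_connected U K"
    and a: "a \<in> U" "K a b"
    using cut_connected_remove_vertex[OF less.prems(1,2) sym less.prems(3,4)] by metis
  show ?case
  proof (cases "U = {a}")
    case True
    then show ?thesis using W b U a by (intro exI[of _ "[a, b]"]) (auto simp: less_2_cases_iff)
  next
    case False
    have "card U < card W" using W b less.prems(1) by simp
    \<comment> \<open>The induction hypothesis is used with the neighbour \<open>a\<close> of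
      \<open>b\<close> as the forbidden last vertex. So \<open>a\<close> sits at least two places
      before \<open>b\<close> once \<open>b\<close> is appended.\<close>
    then obtain xs where xs: "distinct xs" "set xs = U" "last xs \<noteq> a"
      "\<And>j. j < length xs \<Longrightarrow> 0 < j \<Longrightarrow> \<exists>i\<le>j - 2. K (xs ! i) (xs ! j)"
      using less.hyps[of U a] U a False less.prems(1) W by auto
    obtain i where i: "i < length xs" "xs ! i = a" using a xs(2) by (metis in_set_conv_nth)
    have "i \<noteq> length xs - 1" using i xs(3) last_conv_nth[of xs] by fastforce
    then have il: "i \<le> length xs - 2" using i by simp
    have "\<exists>i\<le>j - 2. K ((xs @ [b]) ! i) ((xs @ [b]) ! j)" if j: "j < length (xs @ [b])" "0 < j" for j
    proof (cases "j < length xs")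
      case True
      then obtain i where "i \<le> j - 2" "K (xs ! i) (xs ! j)" using xs(4) j by blast
      then show ?thesis using True by (intro exI[of _ i]) (auto simp: nth_append)
    next
      case False
      then show ?thesis using j i il a by (intro exI[of _ i]) (auto simp: nth_append)
    qed
    then show ?thesis using xs W b U by (intro exI[of _ "xs @ [b]"]) auto
  qed
qed

lemma spread_ordering:
  fixes a :: nat
  assumes "cut_connected {..<a} K" and sym: "\<And>i j. K i j \<Longrightarrow> K j i"
  obtains f where "bij_betw f {..<a} {..<a}"
    and "\<And>j. 0 < j \<Longrightarrow> j < a \<Longrightarrow> \<exists>i\<le>j - 2. K (f i) (f j)"
proof (cases "a \<le> 1")
  case True
  then show thesis using that[of id] by auto
next
  case False
  then have "1 \<in> {..<a}" by simp
  then have "{..<a} \<noteq> {0}" by (metis singletonD zero_neq_one)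
  then have "\<exists>xs. distinct xs \<and> set xs = {..<a} \<and> last xs \<noteq> 0 \<and>
      (\<forall>j<length xs. 0 < j \<longrightarrow> (\<exists>i\<le>j - 2. K (xs ! i) (xs ! j)))"
    using False by (intro spread_ordering_aux[OF finite_lessThan assms(1) sym]) simp_all
  then obtain xs where xs: "distinct xs" "set xs = {..<a}"
    "\<And>j. j < length xs \<Longrightarrow> 0 < j \<Longrightarrow> \<exists>i\<le>j - 2. K (xs ! i) (xs ! j)"
    by blast
  have len: "length xs = a" using xs(1,2) by (metis card_lessThan distinct_card)
  show thesis
  proof (rule that[of "(!) xs"])
    show "bij_betw ((!) xs) {..<a} {..<a}" using bij_betw_nth[OF xs(1)] xs(2) len by simp
    show "\<exists>i\<le>j - 2. K (xs ! i) (xs ! j)" if "0 < j" "j < a" for j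
      using xs(3) that unfolding len by blast
  qed
qed

section \<open>Partition into cliques\<close>

text \<open>Ordered pairs are counted, so \<open>edge_count E A A\<close> is twice the number of
  edges inside \<open>A\<close>, and for the full vertex set it is the degree sum.\<close>

definition edge_count :: "('a \<Rightarrow> 'b \<Rightarrow> bool) \<Rightarrow> 'a set \<Rightarrow> 'b set \<Rightarrow> nat" where
  "edge_count E A B = (\<Sum>u\<in>A. \<Sum>v\<in>B. if E u v then 1 else 0)"

lemma edge_count_commute:
  assumes "\<And>u v. E u v \<Longrightarrow> E v u"
  shows "edge_count E A B = edge_count E B A"
  unfolding edge_count_def by (subst sum.swap) (intro sum.cong refl, use assms in auto)

lemma edge_count_Un_left:
  "finite A \<Longrightarrow> finite B \<Longrightarrow> A \<inter> B = {} \<Longrightarrow>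
    edge_count E (A \<union> B) C = edge_count E A C + edge_count E B C"
  by (simp add: edge_count_def sum.union_disjoint)

lemma edge_count_Un_right:
  "finite B \<Longrightarrow> finite C \<Longrightarrow> B \<inter> C = {} \<Longrightarrow>
    edge_count E A (B \<union> C) = edge_count E A B + edge_count E A C"
  by (simp add: edge_count_def sum.union_disjoint sum.distrib)

lemma edge_count_mono_right: "finite C \<Longrightarrow> B \<subseteq> C \<Longrightarrow> edge_count E A B \<le> edge_count E A C"
  unfolding edge_count_def by (intro sum_mono sum_mono2) auto

lemma edge_count_inside_le:
  assumes "finite A" "\<And>u. \<not> E u u"
  shows "edge_count E A A \<le> card A * (card A - 1)"
proof -
  have "(\<Sum>v\<in>A. if E u v then 1 else 0) \<le> card A - 1" if "u \<in> A" for u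
  proof -
    have "(\<Sum>v\<in>A. if E u v then 1 else 0) = (\<Sum>v\<in>A - {u}. if E u v then 1 else (0::nat))"
      using assms by (intro sum.mono_neutral_right) auto
    also have "\<dots> \<le> (\<Sum>v\<in>A - {u}. 1)" by (intro sum_mono) auto
    finally show ?thesis using that assms by simp
  qed
  then have "edge_count E A A \<le> (\<Sum>u\<in>A. card A - 1)" unfolding edge_count_def by (intro sum_mono)
  then show ?thesis by simp
qed

text \<open>Erdos' greedy proof of Turan's theorem, keeping track of the pairs missing inside the colour
  classes: the new class is the closed neighbourhood of a vertex of minimum degree.\<close>
lemma greedy_clique_colouring:
  assumes "finite W" and sym: "\<And>u v. E u v \<Longrightarrow> E v u" and irrefl: "\<And>u. \<not> E u u"
    and "\<And>S. S \<subseteq> W \<Longrightarrow> (\<forall>u\<in>S. \<forall>v\<in>S. \<not> E u v) \<Longrightarrow> card S \<le> a"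
  shows "\<exists>c. (\<forall>v\<in>W. c v < a) \<and>
    2 * (\<Sum>i<a. card {v\<in>W. c v = i} * (card {v\<in>W. c v = i} - 1))
      \<le> edge_count E W W + (\<Sum>i<a. edge_count E {v\<in>W. c v = i} {v\<in>W. c v = i})"
  using assms(1,4)
proof (induction a arbitrary: W)
  case 0
  have "W = {}"
  proof (rule ccontr)
    assume "W \<noteq> {}"
    then obtain v where "v \<in> W" by blast
    then show False using "0.prems"(2)[of "{v}"] irrefl by simp
  qed
  then show ?case by simp
next
  case (Suc a)
  show ?case
  proof (cases "W = {}")
    case True
    then show ?thesis by simp
  next
    case False
    define d where "d u = (\<Sum>v\<in>W. if E u v then 1 else (0::nat))" for u
    obtain v where v: "v \<in> W" and vmin: "\<And>u. u \<in> W \<Longrightarrow> d v \<le> d u"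
      using ex_min_if_finite[of "d ` W"] False Suc.prems(1) by (metis (no_types, lifting) finite_imageI image_iff image_is_empty not_le)
    define N where "N = insert v {u\<in>W. E v u}"
    define W' where "W' = W - N"
    have fin: "finite N" "finite W'" "N \<inter> W' = {}" and WN: "W = N \<union> W'"
      using Suc.prems(1) v by (auto simp: N_def W'_def)
    have card_N: "card N = Suc (d v)"
      using Suc.prems(1) irrefl
      by (simp add: N_def d_def sum.inter_filter[symmetric])
    \<comment> \<open>No vertex of \<open>W'\<close> is adjacent to \<open>v\<close>, so
      \<open>v\<close> extends every independent subset of \<open>W'\<close> and the bound drops by
      one.\<close>
    have "card S \<le> a" if S: "S \<subseteq> W'" "\<forall>u\<in>S. \<forall>w\<in>S. \<not> E u w" for S
    proof -
      have "\<forall>u\<in>insert v S. \<forall>w\<in>insert v S. \<not> E u w"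
        using S irrefl sym by (auto simp: W'_def N_def)
      then have "card (insert v S) \<le> Suc a" using S v by (intro Suc.prems(2)) (auto simp: W'_def)
      moreover have "v \<notin> S" "finite S" using S fin(2) by (auto simp: W'_def N_def intro: finite_subset)
      ultimately show ?thesis by simp
    qed
    then obtain c where c: "\<forall>v\<in>W'. c v < a"
      "2 * (\<Sum>i<a. card {v\<in>W'. c v = i} * (card {v\<in>W'. c v = i} - 1))
      \<le> edge_count E W' W' + (\<Sum>i<a. edge_count E {v\<in>W'. c v = i} {v\<in>W'. c v = i})"
      using Suc.IH[of W'] fin by auto
    define c' where "c' u = (if u \<in> N then a else c u)" for u
    have old: "{v\<in>W. c' v = i} = {v\<in>W'. c v = i}" if "i < a" for i
      using that by (auto simp: c'_def W'_def)
    have new: "{v\<in>W. c' v = a} = N"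
      using c(1) WN by (auto simp: c'_def)
    have "edge_count E N W = (\<Sum>u\<in>N. d u)" by (simp add: edge_count_def d_def)
    also have "\<dots> \<ge> (\<Sum>u\<in>N. d v)" using WN by (intro sum_mono vmin) auto
    finally have lower: "edge_count E N W \<ge> card N * (card N - 1)" using card_N by simp
    \<comment> \<open>Adding the pairs inside \<open>N\<close> a second time completes the pairs
      touching \<open>N\<close> to two full copies of \<open>N\<close> against \<open>W\<close>, to
      which the degree bound applies.\<close>
    have "edge_count E W W + edge_count E N N = 2 * edge_count E N W + edge_count E W' W'"
      using edge_count_Un_left[OF fin, of E] edge_count_Un_right[OF fin, of E]
        edge_count_commute[of E N W', OF sym] unfolding WN by simp
    then have "2 * (card N * (card N - 1)) + edge_count E W' W' \<le> edge_count E W W + edge_count E N N"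
      using lower by linarith
    then show ?thesis using c old new
      by (intro exI[of _ c']) (auto simp: c'_def W'_def less_Suc_eq)
  qed
qed

text \<open>In the greedy colouring every class has a vertex without neighbours in other classes.
  Two nonadjacent vertices of one class, together with such vertices from the other classes, would
  form an independent set of size \<open>a + 1\<close>.\<close>

lemma clique_partition_of_few_edges:
  assumes G: "simple_graph n E" and n: "n = k * a"
    and ind: "\<And>S. independent_set n E S \<Longrightarrow> card S \<le> a"
    and few: "edge_count E {..<n} {..<n} < n * (k - 1) + 2 * a + 2" and k: "2 * a + 2 < k"
  obtains c where "\<And>v. v < n \<Longrightarrow> c v < a"
    and "\<And>u v. u < n \<Longrightarrow> v < n \<Longrightarrow> u \<noteq> v \<Longrightarrow> c u = c v \<Longrightarrow> E u v"
proof -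
  have sym: "\<And>u v. E u v \<Longrightarrow> E v u" and irrefl: "\<And>u. \<not> E u u" and En: "\<And>u v. E u v \<Longrightarrow> u < n \<and> v < n"
    using G by (auto simp: simple_graph_def)
  have small: "card S \<le> a" if "S \<subseteq> {..<n}" "\<forall>u\<in>S. \<forall>v\<in>S. \<not> E u v" for S
    using ind[of S] that by (simp add: independent_set_def atLeast0LessThan)
  obtain c where c': "\<forall>v\<in>{..<n}. c v < a"
    and gr: "2 * (\<Sum>i<a. card {v\<in>{..<n}. c v = i} * (card {v\<in>{..<n}. c v = i} - 1))
      \<le> edge_count E {..<n} {..<n} + (\<Sum>i<a. edge_count E {v\<in>{..<n}. c v = i} {v\<in>{..<n}. c v = i})"
    using greedy_clique_colouring[of "{..<n}" E a, OF finite_lessThan sym irrefl small] by blast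
  have c: "c v < a" if "v < n" for v using c' that by simp
  define V where "V i = {v\<in>{..<n}. c v = i}" for i
  define s where "s i = card (V i)" for i
  define cross where "cross i = edge_count E (V i) ({..<n} - V i)" for i
  define e where "e = edge_count E {..<n} {..<n}"
  have finV: "finite (V i)" "V i \<subseteq> {..<n}" for i by (auto simp: V_def)
  have split: "(\<Sum>i<a. \<Sum>v\<in>V i. f v) = (\<Sum>v<n. f v)" for f :: "nat \<Rightarrow> nat"
    unfolding V_def using c by (intro sum.group) auto
  have sum_s: "(\<Sum>i<a. s i) = n" using split[of "\<lambda>_. 1"] by (simp add: s_def)
  have V_Un: "{..<n} = V i \<union> ({..<n} - V i)" for i using finV by blast
  have "e = (\<Sum>i<a. edge_count E (V i) {..<n})"
    unfolding e_def edge_count_def by (rule split[symmetric])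
  also have "\<dots> = (\<Sum>i<a. edge_count E (V i) (V i) + cross i)"
  proof (rule sum.cong[OF refl])
    fix i
    have "edge_count E (V i) (V i \<union> ({..<n} - V i)) = edge_count E (V i) (V i) + cross i"
      unfolding cross_def by (intro edge_count_Un_right) (simp_all add: finV)
    then show "edge_count E (V i) {..<n} = edge_count E (V i) (V i) + cross i"
      unfolding V_Un[of i, symmetric] .
  qed
  finally have e_split: "e = (\<Sum>i<a. edge_count E (V i) (V i)) + (\<Sum>i<a. cross i)"
    by (simp add: sum.distrib)
  \<comment> \<open>Each edge leaving class \<open>j\<close> is counted once in
    \<open>cross j\<close> and once in the \<open>cross\<close> of the class at its other
    end.\<close>
  have cross_half: "2 * cross j \<le> (\<Sum>i<a. cross i)" if j: "j < a" for j
  proof -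
    have "cross j = edge_count E ({..<n} - V j) (V j)"
      unfolding cross_def by (rule edge_count_commute[OF sym])
    also have "{..<n} - V j = (\<Union>i\<in>{..<a} - {j}. V i)" using c by (auto simp: V_def)
    also have "edge_count E \<dots> (V j) = (\<Sum>i\<in>{..<a} - {j}. edge_count E (V i) (V j))"
      unfolding edge_count_def by (rule sum.UNION_disjoint) (auto simp: V_def)
    also have "\<dots> \<le> (\<Sum>i\<in>{..<a} - {j}. cross i)"
      unfolding cross_def by (intro sum_mono edge_count_mono_right) (auto simp: V_def)
    finally show ?thesis using j by (simp add: sum.remove[of "{..<a}" j cross])
  qed
  have inside: "edge_count E (V i) (V i) \<le> s i * (s i - 1)" for i
    unfolding s_def by (intro edge_count_inside_le finV irrefl)
  \<comment> \<open>The squared deviation of the class sizes from their mean \<open>k\<close>. It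
    measures by how much the pairs inside the classes exceed \<open>n * (k - 1)\<close>.\<close>
  define D where "D = (\<Sum>i<a. (int (s i) - int k)\<^sup>2)"
  have "int (\<Sum>i<a. s i * (s i - 1)) = (\<Sum>i<a. (int (s i) - int k)\<^sup>2 + (2 * int k - 1) * int (s i) - (int k)\<^sup>2)"
    unfolding of_nat_sum
  proof (intro sum.cong refl)
    fix i show "int (s i * (s i - 1)) = (int (s i) - int k)\<^sup>2 + (2 * int k - 1) * int (s i) - (int k)\<^sup>2"
      by (cases "s i") (auto simp: power2_eq_square algebra_simps)
  qed
  also have "\<dots> = D + (2 * int k - 1) * int n - int a * (int k)\<^sup>2"
    using sum_s by (simp add: D_def sum.distrib sum_subtractf sum_distrib_left[symmetric] of_nat_sum[symmetric] del: of_nat_sum)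
  also have "\<dots> = D + int n * (int k - 1)" by (simp add: n algebra_simps power2_eq_square)
  finally have S2: "int (\<Sum>i<a. s i * (s i - 1)) = D + int n * (int k - 1)" .
  have k1: "int (k - 1) = int k - 1" using k by simp
  \<comment> \<open>If every vertex of class \<open>j\<close> had an outside neighbour, then
    \<open>s j \<le> cross j < 2 * a + 2 - D\<close>, while \<open>k - s j \<le> D\<close>. Together
    this gives \<open>k < 2 * a + 2\<close>, a contradiction.\<close>
  have free: "\<exists>w\<in>V j. \<forall>v<n. c v \<noteq> j \<longrightarrow> \<not> E w v" if j: "j < a" for j
  proof (rule ccontr)
    assume "\<not> ?thesis"
    then have "\<exists>v\<in>{..<n} - V j. E w v" if "w \<in> V j" for w using that by (auto simp: V_def)
    then have "1 \<le> (\<Sum>v\<in>{..<n} - V j. if E w v then 1 else (0::nat))" if "w \<in> V j" for w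
      using that by (auto simp: sum.inter_filter[symmetric] Suc_le_eq card_gt_0_iff)
    then have "(\<Sum>w\<in>V j. 1) \<le> cross j" unfolding cross_def edge_count_def by (intro sum_mono)
    then have sc: "s j \<le> cross j" by (simp add: s_def)
    \<comment> \<open>When this greedy bound is added to \<open>cross_half\<close>, the pairs inside
      the classes cancel, leaving a bound on \<open>cross j\<close>.\<close>
    have "2 * int (\<Sum>i<a. s i * (s i - 1)) \<le> int e + int (\<Sum>i<a. edge_count E (V i) (V i))"
      using gr unfolding V_def[symmetric] s_def[symmetric] e_def[symmetric] by linarith
    moreover have "2 * int (cross j) \<le> int e - int (\<Sum>i<a. edge_count E (V i) (V i))"
      using cross_half[OF j] e_split by linarith
    ultimately have "int (cross j) \<le> int e - D - int n * (int k - 1)" using S2 by linarith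
    moreover have "int e < int n * (int k - 1) + 2 * int a + 2"
    proof -
      have "int e < int (n * (k - 1) + 2 * a + 2)" using few unfolding e_def of_nat_less_iff .
      then show ?thesis by (simp only: of_nat_add of_nat_mult of_nat_numeral k1)
    qed
    moreover have "(int (s j) - int k)\<^sup>2 \<le> D"
      unfolding D_def using j by (intro member_le_sum) auto
    moreover have "int k - int (s j) \<le> (int (s j) - int k)\<^sup>2"
    proof -
      have "x \<le> x\<^sup>2" for x :: int by (cases "x \<le> 0") (auto simp: power2_eq_square intro: order_trans)
      from this[of "int k - int (s j)"] show ?thesis by (simp add: power2_commute)
    qed
    ultimately show False using sc k by linarith
  qed
  then obtain w where w: "\<And>j. j < a \<Longrightarrow> w j \<in> V j" "\<And>j v. j < a \<Longrightarrow> v < n \<Longrightarrow> c v \<noteq> j \<Longrightarrow> \<not> E (w j) v"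
    by metis
  show thesis
  proof (rule that[of c])
    fix u v assume uv: "u < n" "v < n" "u \<noteq> v" "c u = c v"
    show "E u v"
    proof (rule ccontr)
      assume nE: "\<not> E u v"
      define T where "T = w ` ({..<a} - {c u})"
      have cw: "c (w j) = j" "w j < n" if "j < a" for j using w(1)[OF that] by (auto simp: V_def)
      have "inj_on w ({..<a} - {c u})" using cw by (metis DiffD1 inj_onI lessThan_iff)
      then have "card T = a - 1" using c[OF uv(1)] by (simp add: T_def card_image)
      moreover have "u \<notin> T" "v \<notin> T" "finite T" using cw uv by (auto simp: T_def)
      ultimately have card: "card (insert u (insert v T)) = a + 1" using uv c[OF uv(1)] by simp
      have Tout: "\<not> E x y \<and> \<not> E y x" if xy: "x \<in> T" "y < n" "y \<in> T \<or> c y = c u" for x y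
      proof -
        obtain j where j: "j < a" "j \<noteq> c u" "x = w j" using xy by (auto simp: T_def)
        have "\<not> E x y"
        proof (cases "c y = j")
          case True
          then have "y = x" using xy j cw by (auto simp: T_def)
          then show ?thesis using irrefl by simp
        next
          case False
          then show ?thesis using w(2)[of j y] j xy by blast
        qed
        then show ?thesis using sym by blast
      qed
      have "T \<subseteq> {..<n}" using cw by (auto simp: T_def)
      then have "independent_set n E (insert u (insert v T))"
        unfolding independent_set_def using uv nE irrefl sym Tout by auto
      then show False using ind card by fastforce
    qed
  qed (rule c)
qed

section \<open>Graphs partitioned into cliques of equal size\<close>

text \<open>Row \<open>i\<close> of \<open>(D + t A) s\<close>, where \<open>D\<close> is the degree
  matrix and \<open>A\<close> the adjacency matrix of \<open>K\<close>; at \<open>t = 1\<close> this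
  is the signless Laplacian.\<close>

definition coupling :: "nat \<Rightarrow> (nat \<Rightarrow> nat \<Rightarrow> bool) \<Rightarrow> real \<Rightarrow> (nat \<Rightarrow> real) \<Rightarrow> nat \<Rightarrow> real" where
  "coupling a K t s i = (\<Sum>j\<in>{j. j < a \<and> K i j}. s i + t * s j)"

locale clique_blocks =
  fixes n k a :: nat and E :: "nat \<Rightarrow> nat \<Rightarrow> bool" and c :: "nat \<Rightarrow> nat"
  assumes graph: "simple_graph n E"
    and colour_less: "v < n \<Longrightarrow> c v < a"
    and card_block: "i < a \<Longrightarrow> card {v. v < n \<and> c v = i} = k"
    and clique: "u < n \<Longrightarrow> v < n \<Longrightarrow> u \<noteq> v \<Longrightarrow> c u = c v \<Longrightarrow> E u v"
begin

definition block :: "nat \<Rightarrow> nat set" where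
  "block i = {v. v < n \<and> c v = i}"

definition quotient :: "nat \<Rightarrow> nat \<Rightarrow> bool" where
  "quotient i j \<longleftrightarrow> i \<noteq> j \<and> (\<exists>u v. E u v \<and> c u = i \<and> c v = j)"

lemma edgeD: "E u v \<Longrightarrow> u < n \<and> v < n \<and> u \<noteq> v \<and> E v u"
  using graph by (auto simp: simple_graph_def)

lemma quotient_sym: "quotient i j \<Longrightarrow> quotient j i"
  using edgeD by (auto simp: quotient_def)

lemma quotient_irrefl: "\<not> quotient i i"
  by (simp add: quotient_def)

lemma quotient_less: "quotient i j \<Longrightarrow> i < a \<and> j < a"
  using edgeD colour_less by (auto simp: quotient_def)

lemma finite_block [simp]: "finite (block i)"
  by (simp add: block_def)

lemma card_block' [simp]: "i < a \<Longrightarrow> card (block i) = k"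
  by (simp add: block_def card_block)

lemma neighbour_sum:
  fixes x :: "nat \<Rightarrow> real"
  assumes v: "v < n"
  shows "(\<Sum>u\<in>{u. u < n \<and> E v u}. x u) =
    (\<Sum>u\<in>block (c v). x u) - x v + (\<Sum>u\<in>{u. E v u \<and> c u \<noteq> c v}. x u)"
proof -
  have fin: "finite {u. E v u \<and> c u \<noteq> c v}"
    by (rule finite_subset[of _ "{..<n}"]) (auto dest: edgeD)
  have eq: "{u. u < n \<and> E v u} = (block (c v) - {v}) \<union> {u. E v u \<and> c u \<noteq> c v}"
    unfolding set_eq_iff
  proof
    fix u
    show "u \<in> {u. u < n \<and> E v u} \<longleftrightarrow> u \<in> (block (c v) - {v}) \<union> {u. E v u \<and> c u \<noteq> c v}"
      using clique[OF v, of u] edgeD[of v u] by (auto simp: block_def)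
  qed
  have "(\<Sum>u\<in>{u. u < n \<and> E v u}. x u) = (\<Sum>u\<in>block (c v) - {v}. x u) + (\<Sum>u\<in>{u. E v u \<and> c u \<noteq> c v}. x u)"
    unfolding eq using fin by (intro sum.union_disjoint) (auto simp: block_def)
  also have "(\<Sum>u\<in>block (c v) - {v}. x u) = (\<Sum>u\<in>block (c v). x u) - x v"
    using v by (subst sum_diff1) (auto simp: block_def)
  finally show ?thesis .
qed

text \<open>One edge is selected for every pair of adjacent blocks; \<open>p i j\<close> is its end
  in block \<open>i\<close> on the side of block \<open>j\<close>.\<close>

definition attachment :: "(nat \<Rightarrow> nat \<Rightarrow> nat) \<Rightarrow> bool" where
  "attachment p \<longleftrightarrow> (\<forall>i j. quotient i j \<longrightarrow> E (p i j) (p j i) \<and> c (p i j) = i)"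

lemma attachment_exists: "\<exists>p. attachment p"
proof -
  have "\<forall>i j. \<exists>e. quotient i j \<longrightarrow> E (fst e) (snd e) \<and> c (fst e) = i \<and> c (snd e) = j"
    by (auto simp: quotient_def)
  then obtain e where e: "\<And>i j. quotient i j \<Longrightarrow>
      E (fst (e i j)) (snd (e i j)) \<and> c (fst (e i j)) = i \<and> c (snd (e i j)) = j"
    by metis
  \<comment> \<open>Choosing the edge only for \<open>i < j\<close> and reading it backwards
    otherwise makes \<open>p i j\<close> and \<open>p j i\<close> the two ends of the same
    edge.\<close>
  define p where "p i j = (if i < j then fst (e i j) else snd (e j i))" for i j
  have "attachment p"
    unfolding attachment_def
  proof (intro allI impI)
    fix i j assume q: "quotient i j"
    then have "i \<noteq> j" using quotient_irrefl by metis
    then consider "i < j" | "j < i" by linarith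
    then show "E (p i j) (p j i) \<and> c (p i j) = i"
    proof cases
      case 1
      then show ?thesis using e[OF q] by (simp add: p_def)
    next
      case 2
      then show ?thesis using e[OF quotient_sym[OF q]] edgeD by (simp add: p_def)
    qed
  qed
  then show ?thesis by blast
qed

text \<open>The selected edges are all the edges between blocks and no two of them meet: the cross
  edges form a matching with at most one edge per pair of blocks.\<close>

definition exact_attachment :: "(nat \<Rightarrow> nat \<Rightarrow> nat) \<Rightarrow> bool" where
  "exact_attachment p \<longleftrightarrow> attachment p \<and>
    (\<forall>i j l. quotient i j \<longrightarrow> quotient i l \<longrightarrow> p i j = p i l \<longrightarrow> j = l) \<and>
    (\<forall>u v. E u v \<longrightarrow> c u \<noteq> c v \<longrightarrow> p (c u) (c v) = u)"

lemma sum_over_attachments: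
  fixes f :: "nat \<Rightarrow> real"
  assumes p: "attachment p"
  shows "(\<Sum>v\<in>block i. \<Sum>j\<in>{j. j < a \<and> quotient i j \<and> p i j = v}. f j) = (\<Sum>j\<in>{j. j < a \<and> quotient i j}. f j)"
proof -
  have "(\<Sum>v\<in>block i. \<Sum>j\<in>{j\<in>{j. j < a \<and> quotient i j}. p i j = v}. f j) = (\<Sum>j\<in>{j. j < a \<and> quotient i j}. f j)"
    using p edgeD by (intro sum.group) (auto simp: attachment_def block_def)
  then show ?thesis by (simp add: conj_assoc)
qed

text \<open>With \<open>t = \<lambda> + 1\<close>, the eigenvalue equation reads \<open>t x\<^sub>v = S\<^sub>i + x\<^sub>w\<close> at an attachment
  vertex \<open>v\<close> of block \<open>i\<close> with outer neighbour \<open>w\<close>; eliminating the vertices leaves a system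
  for the block sums.\<close>
lemma block_sums_of_eigenvector:
  assumes p: "exact_attachment p" and t: "t > 1"
    and eig: "\<And>v. v < n \<Longrightarrow> (\<Sum>u\<in>{u. u < n \<and> E v u}. x u) = (t - 1) * x v"
    and i: "i < a"
  shows "coupling a quotient t (\<lambda>i. \<Sum>v\<in>block i. x v) i = (t - k) * (t\<^sup>2 - 1) * (\<Sum>v\<in>block i. x v)"
proof -
  define S where "S i = (\<Sum>v\<in>block i. x v)" for i
  have att: "attachment p" using p by (simp add: exact_attachment_def)
  have outer: "t * x v = S (c v) + (\<Sum>j\<in>{j. j < a \<and> quotient (c v) j \<and> p (c v) j = v}. x (p j (c v)))"
    if v: "v < n" for v
  proof -
    have "{u. E v u \<and> c u \<noteq> c v} = (\<lambda>j. p j (c v)) ` {j. j < a \<and> quotient (c v) j \<and> p (c v) j = v}"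
    proof (intro equalityI subsetI)
      fix u assume "u \<in> {u. E v u \<and> c u \<noteq> c v}"
      then have u: "E v u" "E u v" "c u \<noteq> c v" using edgeD by auto
      then have "quotient (c v) (c u)" unfolding quotient_def by metis
      moreover have "p (c v) (c u) = v" "p (c u) (c v) = u"
        using p u unfolding exact_attachment_def by metis+
      ultimately show "u \<in> (\<lambda>j. p j (c v)) ` {j. j < a \<and> quotient (c v) j \<and> p (c v) j = v}"
        using colour_less[of u] edgeD[OF u(1)] by force
    next
      fix u assume "u \<in> (\<lambda>j. p j (c v)) ` {j. j < a \<and> quotient (c v) j \<and> p (c v) j = v}"
      then obtain j where j: "quotient (c v) j" "p (c v) j = v" "u = p j (c v)" by auto
      then have "E v u \<and> c u = j" using att quotient_sym unfolding attachment_def by metis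
      then show "u \<in> {u. E v u \<and> c u \<noteq> c v}" using j quotient_irrefl by auto
    qed
    moreover have "inj_on (\<lambda>j. p j (c v)) {j. j < a \<and> quotient (c v) j \<and> p (c v) j = v}"
      using att quotient_sym unfolding attachment_def inj_on_def by (metis (mono_tags, lifting) mem_Collect_eq)
    ultimately have "(\<Sum>u\<in>{u. E v u \<and> c u \<noteq> c v}. x u) =
        (\<Sum>j\<in>{j. j < a \<and> quotient (c v) j \<and> p (c v) j = v}. x (p j (c v)))"
      by (simp add: sum.reindex)
    then show ?thesis using eig[OF v] unfolding neighbour_sum[OF v] by (simp add: S_def algebra_simps)
  qed
  have att_eq: "t * x (p i j) = S i + x (p j i)" if q: "quotient i j" for i j
  proof -
    have e: "E (p i j) (p j i)" "c (p i j) = i" using att q by (auto simp: attachment_def)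
    have "{l. l < a \<and> quotient i l \<and> p i l = p i j} = {j}"
      using p q quotient_less unfolding exact_attachment_def by blast
    then show ?thesis using outer[of "p i j"] e edgeD[OF e(1)] by simp
  qed
  \<comment> \<open>The equations \<open>att_eq\<close> at the two ends of an edge form a 2 by 2
    system with determinant \<open>t^2 - 1\<close>.\<close>
  have att_val: "(t\<^sup>2 - 1) * x (p j i) = S i + t * S j" if q: "quotient i j" for i j
  proof -
    have "t * (t * x (p j i)) = t * S j + t * x (p i j)"
      by (simp add: att_eq[OF quotient_sym[OF q]] distrib_left)
    then show ?thesis using att_eq[OF q] by (simp add: algebra_simps power2_eq_square)
  qed
  \<comment> \<open>Summing the vertex equations over the block leaves only values at attachment
    vertices, which \<open>att_val\<close> replaces after multiplication by
    \<open>t^2 - 1\<close>.\<close>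
  have "t * S i = (\<Sum>v\<in>block i. S i + (\<Sum>j\<in>{j. j < a \<and> quotient i j \<and> p i j = v}. x (p j i)))"
    unfolding S_def[of i] sum_distrib_left
    by (intro sum.cong refl) (use outer in \<open>auto simp: block_def S_def\<close>)
  also have "\<dots> = k * S i + (\<Sum>j\<in>{j. j < a \<and> quotient i j}. x (p j i))"
    using i by (simp add: sum.distrib sum_over_attachments[OF att])
  finally have "(t\<^sup>2 - 1) * (t * S i) = (t\<^sup>2 - 1) * (k * S i) + (\<Sum>j\<in>{j. j < a \<and> quotient i j}. (t\<^sup>2 - 1) * x (p j i))"
    by (simp add: distrib_left sum_distrib_left)
  also have "(\<Sum>j\<in>{j. j < a \<and> quotient i j}. (t\<^sup>2 - 1) * x (p j i)) = coupling a quotient t S i"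
    unfolding coupling_def by (intro sum.cong refl att_val) simp
  finally show ?thesis unfolding S_def[abs_def] by (simp add: algebra_simps)
qed

section \<open>Lifting block values to a test vector on the vertices\<close>

context
  fixes p :: "nat \<Rightarrow> nat \<Rightarrow> nat" and t :: real and s :: "nat \<Rightarrow> real"
  assumes p: "attachment p" and t: "t > 1" and s: "\<And>i. i < a \<Longrightarrow> s i \<ge> 0"
begin

text \<open>For block sums \<open>s\<close>, the eigenvalue equations at the ends of an isolated
  cross edge are solved by \<open>(t * s i + s j) / (t^2 - 1)\<close>, which is
  \<open>s i / t + bump i j\<close>.\<close>

definition bump :: "nat \<Rightarrow> nat \<Rightarrow> real" where
  "bump i j = (s i + t * s j) / (t * (t\<^sup>2 - 1))"

text \<open>The contributions are superposed: a vertex serving several neighbouring blocks collects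
  one bump for each of them.\<close>

definition lifted :: "nat \<Rightarrow> real" where
  "lifted v = s (c v) / t + (\<Sum>j\<in>{j. j < a \<and> quotient (c v) j \<and> p (c v) j = v}. bump (c v) j)"

lemma t_sq: "t\<^sup>2 - 1 > 0"
  using t by simp

lemma bump_nonneg: "quotient i j \<Longrightarrow> bump i j \<ge> 0"
  unfolding bump_def using s[of i] s[of j] t t_sq quotient_less[of i j] by (intro divide_nonneg_pos) auto

text \<open>This is the local eigenvalue equation along a selected edge: the value at the far end
  matches \<open>t\<close> times the bump at the near end.\<close>

lemma bump_swap: "s j / t + bump j i = t * bump i j"
proof -
  define D where "D = t\<^sup>2 - 1"
  have D: "D > 0" "D + 1 = t * t" using t_sq by (simp_all add: D_def power2_eq_square)
  have "s j / t + (s j + t * s i) / (t * D) = ((D + 1) * s j + t * s i) / (t * D)"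
    using t D(1) by (simp add: field_simps)
  also have "\<dots> = t * ((s i + t * s j) / (t * D))" unfolding D(2) by (simp add: algebra_simps)
  finally show ?thesis by (simp add: bump_def D_def)
qed

lemma lifted_ge: "v < n \<Longrightarrow> lifted v \<ge> s (c v) / t"
  unfolding lifted_def by (simp, intro sum_nonneg bump_nonneg) auto

lemma lifted_nonneg: "v < n \<Longrightarrow> lifted v \<ge> 0"
  using lifted_ge[of v] s[OF colour_less, of v] t by (smt (verit) divide_nonneg_pos)

lemma lifted_attachment_ge:
  assumes "finite J" "J \<noteq> {}" and J: "\<And>j. j \<in> J \<Longrightarrow> quotient i j \<and> p i j = v"
  shows "lifted v \<ge> s i / t + (\<Sum>j\<in>J. bump i j)"
proof -
  have "c v = i" using assms p by (auto simp: attachment_def)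
  moreover have "(\<Sum>j\<in>J. bump i j) \<le> (\<Sum>j\<in>{j. j < a \<and> quotient i j \<and> p i j = v}. bump i j)"
    using J quotient_less bump_nonneg by (intro sum_mono2) auto
  ultimately show ?thesis by (simp add: lifted_def)
qed

lemma sum_block_lifted:
  assumes i: "i < a"
  shows "(\<Sum>v\<in>block i. lifted v) = k * s i / t + coupling a quotient t s i / (t * (t\<^sup>2 - 1))"
proof -
  have "(\<Sum>v\<in>block i. lifted v) =
      (\<Sum>v\<in>block i. s i / t + (\<Sum>j\<in>{j. j < a \<and> quotient i j \<and> p i j = v}. bump i j))"
    by (intro sum.cong) (auto simp: lifted_def block_def)
  also have "\<dots> = k * s i / t + (\<Sum>j\<in>{j. j < a \<and> quotient i j}. bump i j)"
    using i by (simp add: sum.distrib sum_over_attachments[OF p])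
  also have "(\<Sum>j\<in>{j. j < a \<and> quotient i j}. bump i j) = coupling a quotient t s i / (t * (t\<^sup>2 - 1))"
    by (simp only: bump_def coupling_def sum_divide_distrib)
  finally show ?thesis .
qed

definition outer_sum :: "nat \<Rightarrow> real" where
  "outer_sum v = (\<Sum>u\<in>{u. E v u \<and> c u \<noteq> c v}. lifted u)"

text \<open>The defect of the eigenvalue equation splits in two. The first part is the deviation of
  the block sum of \<open>lifted\<close> from \<open>s\<close>, governed by the coupling; the second
  compares the outer neighbours of \<open>v\<close> with the bumps at \<open>v\<close>.\<close>

lemma lifted_excess:
  assumes v: "v < n"
  shows "(\<Sum>u\<in>{u. u < n \<and> E v u}. lifted u) - (t - 1) * lifted v =
    (coupling a quotient t s (c v) - (t - k) * (t\<^sup>2 - 1) * s (c v)) / (t * (t\<^sup>2 - 1)) +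
    (outer_sum v - (\<Sum>j\<in>{j. j < a \<and> quotient (c v) j \<and> p (c v) j = v}. t * bump (c v) j))"
proof -
  have "t * lifted v = s (c v) + (\<Sum>j\<in>{j. j < a \<and> quotient (c v) j \<and> p (c v) j = v}. t * bump (c v) j)"
    using t by (simp add: lifted_def distrib_left sum_distrib_left)
  moreover have "k * z / t + C / (t * D) - z = (C - (t - k) * D * z) / (t * D)" if "D > 0" for C D z :: real
    using t that by (simp add: field_simps)
  note this[OF t_sq, of "s (c v)"]
  ultimately show ?thesis
    unfolding neighbour_sum[OF v] sum_block_lifted[OF colour_less[OF v]] outer_sum_def[symmetric]
    by (simp add: algebra_simps)
qed

lemma attached_subset_outer:
  "(\<lambda>j. p j (c v)) ` {j. j < a \<and> quotient (c v) j \<and> p (c v) j = v} \<subseteq> {u. E v u \<and> c u \<noteq> c v}"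
proof
  fix u assume "u \<in> (\<lambda>j. p j (c v)) ` {j. j < a \<and> quotient (c v) j \<and> p (c v) j = v}"
  then obtain j where j: "quotient (c v) j" "p (c v) j = v" "u = p j (c v)" by auto
  then have "E v u \<and> c u = j" using p quotient_sym unfolding attachment_def by metis
  then show "u \<in> {u. E v u \<and> c u \<noteq> c v}" using j quotient_irrefl by auto
qed

lemma finite_outer: "finite {u. E v u \<and> c u \<noteq> c v}"
  by (rule finite_subset[of _ "{..<n}"]) (auto dest: edgeD)

lemma sum_attached:
  "(\<Sum>u\<in>(\<lambda>j. p j (c v)) ` {j. j < a \<and> quotient (c v) j \<and> p (c v) j = v}. lifted u) =
   (\<Sum>j\<in>{j. j < a \<and> quotient (c v) j \<and> p (c v) j = v}. lifted (p j (c v)))"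
proof -
  have "inj_on (\<lambda>j. p j (c v)) {j. j < a \<and> quotient (c v) j \<and> p (c v) j = v}"
    using p quotient_sym unfolding attachment_def inj_on_def by (metis (mono_tags, lifting) mem_Collect_eq)
  then show ?thesis by (simp add: sum.reindex)
qed

lemma lifted_attached_ge: "quotient i j \<Longrightarrow> lifted (p j i) \<ge> t * bump i j"
  using lifted_attachment_ge[of "{i}" j "p j i"] quotient_sym[of i j] bump_swap[of j i] by simp

text \<open>Every selected edge at \<open>v\<close> pays for its bump by
  \<open>lifted_attached_ge\<close>, and further cross edges only add nonnegative values.\<close>

lemma outer_sum_ge: "outer_sum v \<ge> (\<Sum>j\<in>{j. j < a \<and> quotient (c v) j \<and> p (c v) j = v}. t * bump (c v) j)"
proof -
  have "outer_sum v \<ge> (\<Sum>j\<in>{j. j < a \<and> quotient (c v) j \<and> p (c v) j = v}. lifted (p j (c v)))"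
    unfolding outer_sum_def sum_attached[symmetric]
    using lifted_nonneg edgeD by (intro sum_mono2 finite_outer attached_subset_outer) blast
  moreover have "(\<Sum>j\<in>{j. j < a \<and> quotient (c v) j \<and> p (c v) j = v}. lifted (p j (c v)))
      \<ge> (\<Sum>j\<in>{j. j < a \<and> quotient (c v) j \<and> p (c v) j = v}. t * bump (c v) j)"
    by (intro sum_mono lifted_attached_ge) auto
  ultimately show ?thesis by linarith
qed

lemma outer_sum_gt_of_extra_edge:
  assumes e: "E v u" "c u \<noteq> c v" "p (c u) (c v) \<noteq> u \<or> p (c v) (c u) \<noteq> v" and pos: "lifted u > 0"
  shows "outer_sum v > (\<Sum>j\<in>{j. j < a \<and> quotient (c v) j \<and> p (c v) j = v}. t * bump (c v) j)"
proof -
  let ?J = "{j. j < a \<and> quotient (c v) j \<and> p (c v) j = v}"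
  have "u \<notin> (\<lambda>j. p j (c v)) ` ?J"
  proof
    assume "u \<in> (\<lambda>j. p j (c v)) ` ?J"
    then obtain j where j: "quotient (c v) j" "p (c v) j = v" "u = p j (c v)" by auto
    then have "c u = j" using p quotient_sym unfolding attachment_def by metis
    then show False using e j by auto
  qed
  then have "(\<Sum>w\<in>(\<lambda>j. p j (c v)) ` ?J. lifted w) < outer_sum v"
    unfolding outer_sum_def using e pos lifted_nonneg edgeD
    by (intro sum_strict_mono2[where b = u] finite_outer attached_subset_outer) auto
  moreover have "(\<Sum>w\<in>(\<lambda>j. p j (c v)) ` ?J. lifted w) \<ge> (\<Sum>j\<in>?J. t * bump (c v) j)"
    unfolding sum_attached by (intro sum_mono lifted_attached_ge) auto
  ultimately show ?thesis by linarith
qed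

text \<open>The vertex \<open>p i j\<close> also carries the positive bump towards \<open>l\<close>,
  so its neighbour \<open>p j i\<close> receives more than the edge between blocks \<open>i\<close>
  and \<open>j\<close> requires.\<close>

lemma outer_sum_gt_of_shared_attachment:
  assumes q: "quotient i j" "quotient i l" "j \<noteq> l" "p i j = p i l" and pos: "s i > 0"
  shows "outer_sum (p j i) > (\<Sum>m\<in>{m. m < a \<and> quotient (c (p j i)) m \<and> p (c (p j i)) m = p j i}. t * bump (c (p j i)) m)"
proof -
  have cj: "c (p j i) = j" using p quotient_sym[OF q(1)] by (simp add: attachment_def)
  let ?J = "{m. m < a \<and> quotient j m \<and> p j m = p j i}"
  have "bump i l > 0"
    unfolding bump_def using pos s[of l] t t_sq quotient_less[OF q(2)]
    by (intro divide_pos_pos) (auto intro: add_pos_nonneg)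
  then have "lifted (p i j) > t * bump j i"
  proof -
    have "lifted (p i j) \<ge> s i / t + (\<Sum>m\<in>{j, l}. bump i m)"
      by (rule lifted_attachment_ge) (use q in auto)
    then show ?thesis using \<open>bump i l > 0\<close> q(3) bump_swap[of i j] by simp
  qed
  then have "(\<Sum>m\<in>?J. t * bump j m) < (\<Sum>m\<in>?J. lifted (p m j))"
    using lifted_attached_ge quotient_sym[OF q(1)] quotient_less[OF q(1)]
    by (intro sum_strict_mono_ex1) auto
  also have "\<dots> = (\<Sum>w\<in>(\<lambda>m. p m j) ` ?J. lifted w)"
    using sum_attached[of "p j i"] unfolding cj by simp
  also have "\<dots> \<le> outer_sum (p j i)"
    unfolding outer_sum_def
    using lifted_nonneg edgeD attached_subset_outer[of "p j i"] unfolding cj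
    by (intro sum_mono2) (use finite_outer[of "p j i"] cj in auto)
  finally show ?thesis unfolding cj .
qed

text \<open>Both parts of the excess are nonnegative, so \<open>lifted\<close> is a subsolution for
  \<open>t - 1\<close>; it is strict at \<open>v\<close>, where its value is positive.\<close>

lemma spectral_radius_gt_of_coupling:
  assumes n: "n > 0" and k: "k > 0"
    and cpl: "\<And>i. i < a \<Longrightarrow> coupling a quotient t s i \<ge> (t - k) * (t\<^sup>2 - 1) * s i"
    and v: "v < n" "lifted v > 0"
    and strict: "coupling a quotient t s (c v) > (t - k) * (t\<^sup>2 - 1) * s (c v) \<or>
      outer_sum v > (\<Sum>j\<in>{j. j < a \<and> quotient (c v) j \<and> p (c v) j = v}. t * bump (c v) j)"
  shows "graph_spectral_radius n E > t - 1"
proof (rule graph_spectral_radius_gt[OF n graph, where x = lifted and l = v])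
  have den: "t * (t\<^sup>2 - 1) > 0" using t t_sq by simp
  have ex: "(coupling a quotient t s (c u) - (t - k) * (t\<^sup>2 - 1) * s (c u)) / (t * (t\<^sup>2 - 1)) \<ge> 0" if "u < n" for u
    using cpl[OF colour_less[OF that]] den by (intro divide_nonneg_pos) auto
  show "(t - 1) * lifted u \<le> (\<Sum>j | j < n \<and> E u j. lifted j)" if "u < n" for u
    using lifted_excess[OF that] ex[OF that] outer_sum_ge[of u] by linarith
  show "(t - 1) * lifted v < (\<Sum>j | j < n \<and> E v j. lifted j)"
    using strict
  proof
    assume "coupling a quotient t s (c v) > (t - k) * (t\<^sup>2 - 1) * s (c v)"
    then have "(coupling a quotient t s (c v) - (t - k) * (t\<^sup>2 - 1) * s (c v)) / (t * (t\<^sup>2 - 1)) > 0"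
      using den by (intro divide_pos_pos) auto
    then show ?thesis using lifted_excess[OF v(1)] outer_sum_ge[of v] by linarith
  next
    assume "outer_sum v > (\<Sum>j\<in>{j. j < a \<and> quotient (c v) j \<and> p (c v) j = v}. t * bump (c v) j)"
    then show ?thesis using lifted_excess[OF v(1)] ex[OF v(1)] by linarith
  qed
qed (use v lifted_nonneg in auto)

end

lemma spectral_radius_gt_of_strict_coupling:
  assumes n: "n > 0" and k: "k > 0" and t: "t > 1" and s: "\<And>i. i < a \<Longrightarrow> s i \<ge> 0"
    and cpl: "\<And>i. i < a \<Longrightarrow> coupling a quotient t s i \<ge> (t - k) * (t\<^sup>2 - 1) * s i"
    and i: "i < a" "s i > 0" "coupling a quotient t s i > (t - k) * (t\<^sup>2 - 1) * s i"
  shows "graph_spectral_radius n E > t - 1"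
proof -
  obtain p where p: "attachment p" using attachment_exists by blast
  have "card (block i) > 0" using card_block[OF i(1)] k by (simp add: block_def)
  then obtain v where v: "v < n" "c v = i" by (force simp: card_gt_0_iff block_def)
  have "s (c v) / t > 0" using v i(2) t by simp
  then have "lifted p t s v > 0" using lifted_ge[of p t s, OF p t s v(1)] by linarith
  then show ?thesis using spectral_radius_gt_of_coupling[of p t s, OF p t s n k cpl v(1)] v i(3) by simp
qed

text \<open>A positive \<open>s\<close> lifts to a positive vector, so a shared attachment vertex or
  an unselected cross edge would create a strict row and raise the spectral radius above
  \<open>t - 1\<close>.\<close>

lemma exact_attachment_of_spectral_radius_le:
  assumes n: "n > 0" and k: "k > 0" and t: "t > 1" and s: "\<And>i. i < a \<Longrightarrow> s i > 0"
    and cpl: "\<And>i. i < a \<Longrightarrow> coupling a quotient t s i \<ge> (t - k) * (t\<^sup>2 - 1) * s i"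
    and le: "graph_spectral_radius n E \<le> t - 1"
  shows "\<exists>p. exact_attachment p"
proof -
  obtain p where p: "attachment p" using attachment_exists by blast
  have s0: "\<And>i. i < a \<Longrightarrow> s i \<ge> 0" using s by (simp add: less_imp_le)
  have pos: "lifted p t s v > 0" if "v < n" for v
  proof -
    have "s (c v) / t > 0" using s[OF colour_less[OF that]] t by simp
    then show ?thesis using lifted_ge[of p t s, OF p t s0 that] by linarith
  qed
  have no: "\<not> outer_sum p t s v > (\<Sum>j\<in>{j. j < a \<and> quotient (c v) j \<and> p (c v) j = v}. t * bump t s (c v) j)"
    if "v < n" for v
    using spectral_radius_gt_of_coupling[of p t s, OF p t s0 n k cpl that pos[OF that]] le by linarith
  have "j = l" if q: "quotient i j" "quotient i l" "p i j = p i l" for i j l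
  proof (rule ccontr)
    assume "j \<noteq> l"
    moreover have "p j i < n" using p q edgeD unfolding attachment_def by metis
    ultimately show False
      using outer_sum_gt_of_shared_attachment[of p t s, OF p t s0 q(1,2)] q(3) s quotient_less[OF q(1)] no by blast
  qed
  moreover have "p (c u) (c v) = u" if e: "E u v" "c u \<noteq> c v" for u v
    using outer_sum_gt_of_extra_edge[of p t s v u, OF p t s0] no[of v] edgeD[OF e(1)] e pos[of u] by metis
  ultimately have "exact_attachment p" using p unfolding exact_attachment_def by blast
  then show ?thesis by blast
qed

section \<open>Renaming blocks and connectivity of the quotient\<close>

lemma relabel:
  assumes f: "bij_betw f {..<a} {..<a}"
  shows "clique_blocks n k a E (f \<circ> c)"
proof
  have inj: "f i = f j \<longleftrightarrow> i = j" if "i < a" "j < a" for i j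
    using f that by (auto simp: bij_betw_def inj_on_def)
  show "(f \<circ> c) v < a" if "v < n" for v using colour_less[OF that] f by (auto simp: bij_betw_def)
  show "card {v. v < n \<and> (f \<circ> c) v = i} = k" if i: "i < a" for i
  proof -
    obtain j where j: "j < a" "i = f j" using f i by (auto simp: bij_betw_def)
    then have "{v. v < n \<and> (f \<circ> c) v = i} = {v. v < n \<and> c v = j}"
      using inj[OF colour_less j(1)] by auto
    then show ?thesis using card_block[OF j(1)] by simp
  qed
  show "E u v" if "u < n" "v < n" "u \<noteq> v" "(f \<circ> c) u = (f \<circ> c) v" for u v
    using that inj[OF colour_less colour_less] clique by simp
qed (rule graph)

lemma quotient_relabel:
  assumes f: "bij_betw f {..<a} {..<a}" and "i < a" "j < a"
  shows "clique_blocks.quotient E (f \<circ> c) (f i) (f j) = quotient i j"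
proof -
  have inj: "f i = f j \<longleftrightarrow> i = j" if "i < a" "j < a" for i j
    using f that by (auto simp: bij_betw_def inj_on_def)
  have "c u < a \<and> c v < a" if "E u v" for u v using edgeD[OF that] colour_less by simp
  then show ?thesis
    unfolding quotient_def clique_blocks.quotient_def[OF relabel[OF f]]
    using inj assms by (metis comp_apply)
qed

text \<open>A walk in \<open>E\<close> from a vertex with colour in \<open>A\<close> to one with
  colour outside \<open>A\<close> must contain an edge that crosses the cut.\<close>

lemma cut_connected_quotient:
  assumes con: "connected_graph n E" and k: "k > 0"
  shows "cut_connected {..<a} quotient"
  unfolding cut_connected_def
proof (intro allI impI)
  fix A assume A: "A \<subseteq> {..<a}" "A \<noteq> {}" "A \<noteq> {..<a}"
  have ex: "\<exists>v<n. c v = i" if "i < a" for i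
    using card_block[OF that] k by (metis (mono_tags, lifting) card.empty empty_Collect_eq less_numeral_extra(3))
  obtain u v where u: "u < n" "c u \<in> A" and v: "v < n" "c v \<notin> A"
    using A ex by (metis lessThan_iff subset_antisym subset_eq ex_in_conv)
  have "E\<^sup>*\<^sup>* u v" using con u v by (simp add: connected_graph_def)
  then have "v < n \<and> (c v \<notin> A \<longrightarrow> (\<exists>x y. E x y \<and> c x \<in> A \<and> c y \<notin> A))"
  proof (induction rule: rtranclp_induct)
    case base
    then show ?case using u by simp
  next
    case (step y z)
    then show ?case using edgeD[of y z] by blast
  qed
  then obtain x y where xy: "E x y" "c x \<in> A" "c y \<notin> A" using v by blast
  then have "quotient (c x) (c y)" unfolding quotient_def by metis
  then show "\<exists>a'\<in>A. \<exists>b\<in>{..<a} - A. quotient a' b"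
    using xy colour_less edgeD[OF xy(1)] by blast
qed

end

section \<open>Comparison with the path\<close>

lemma coupling_relabel:
  assumes f: "bij_betw f {..<a} {..<a}" and K: "\<And>i j. i < a \<Longrightarrow> j < a \<Longrightarrow> K' (f i) (f j) = K i j"
    and i: "i < a"
  shows "coupling a K' t s (f i) = coupling a K t (s \<circ> f) i"
proof -
  have "bij_betw f {j. j < a \<and> K i j} {j. j < a \<and> K' (f i) j}"
  proof (rule bij_betw_subset[OF f])
    show "f ` {j. j < a \<and> K i j} = {j. j < a \<and> K' (f i) j}"
    proof (intro equalityI subsetI)
      fix l assume l: "l \<in> {j. j < a \<and> K' (f i) j}"
      then obtain j where "j < a" "l = f j" using bij_betw_imp_surj_on[OF f] by blast
      then show "l \<in> f ` {j. j < a \<and> K i j}" using l K[OF i] by auto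
    next
      fix l assume "l \<in> f ` {j. j < a \<and> K i j}"
      then show "l \<in> {j. j < a \<and> K' (f i) j}" using K[OF i] bij_betwE[OF f] by auto
    qed
  qed auto
  then show ?thesis unfolding coupling_def comp_def by (rule sum.reindex_bij_betw[symmetric])
qed

definition coupling_matrix :: "nat \<Rightarrow> (nat \<Rightarrow> nat \<Rightarrow> bool) \<Rightarrow> real \<Rightarrow> nat \<Rightarrow> nat \<Rightarrow> real" where
  "coupling_matrix a K t i j = (if i = j then real (card {l. l < a \<and> K i l}) else 0) + (if K i j then t else 0)"

lemma coupling_matrix_mult:
  assumes i: "i < a"
  shows "(\<Sum>j<a. coupling_matrix a K t i j * s j) = coupling a K t s i"
proof -
  have "(\<Sum>j<a. coupling_matrix a K t i j * s j) =
      (\<Sum>j<a. (if i = j then real (card {l. l < a \<and> K i l}) * s i else 0) + t * (adj K i j * s j))"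
    by (intro sum.cong) (auto simp: coupling_matrix_def adj_def distrib_right)
  also have "\<dots> = real (card {l. l < a \<and> K i l}) * s i + t * (\<Sum>j\<in>{j. j < a \<and> K i j}. s j)"
    using i by (simp add: sum.distrib sum_adj sum_distrib_left[symmetric])
  finally show ?thesis by (simp add: coupling_def sum.distrib sum_distrib_left)
qed

lemma quadratic_form_coupling:
  "quadratic_form a (coupling_matrix a K t) s = (\<Sum>i<a. s i * coupling a K t s i)"
  unfolding quadratic_form_def
  by (intro sum.cong refl) (simp add: coupling_matrix_mult[symmetric] sum_distrib_left mult_ac)

lemma sum_square_split:
  fixes g :: "nat \<Rightarrow> nat \<Rightarrow> real"
  shows "(\<Sum>i<a. \<Sum>j<a. g i j) = (\<Sum>j<a. g j j + (\<Sum>i<j. g i j + g j i))"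
  by (induction a) (simp_all add: sum.distrib)

definition edge_weight :: "real \<Rightarrow> (nat \<Rightarrow> real) \<Rightarrow> nat \<Rightarrow> nat \<Rightarrow> real" where
  "edge_weight t s i j = (s i)\<^sup>2 + (s j)\<^sup>2 + 2 * t * s i * s j"

text \<open>Each edge contributes one \<open>edge_weight\<close>, filed under its larger end. Forms
  of different graphs can then be compared position by position.\<close>

lemma quadratic_form_edges:
  assumes sym: "\<And>i j. K i j \<Longrightarrow> K j i" and irrefl: "\<And>i. \<not> K i i"
  shows "quadratic_form a (coupling_matrix a K t) s = (\<Sum>j<a. \<Sum>i\<in>{i. i < j \<and> K i j}. edge_weight t s i j)"
proof -
  define g where "g i j = (if K i j then (s i)\<^sup>2 + t * s i * s j else 0)" for i j
  have "quadratic_form a (coupling_matrix a K t) s = (\<Sum>i<a. \<Sum>j\<in>{j. j < a \<and> K i j}. (s i)\<^sup>2 + t * s i * s j)"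
    unfolding quadratic_form_coupling
    by (simp add: coupling_def sum_distrib_left algebra_simps power2_eq_square)
  also have "\<dots> = (\<Sum>i<a. \<Sum>j<a. g i j)"
  proof (rule sum.cong[OF refl])
    fix i
    show "(\<Sum>j\<in>{j. j < a \<and> K i j}. (s i)\<^sup>2 + t * s i * s j) = (\<Sum>j<a. g i j)"
      using sum.inter_filter[OF finite_lessThan, of "\<lambda>j. (s i)\<^sup>2 + t * s i * s j" a "K i"]
      by (simp add: g_def)
  qed
  also have "\<dots> = (\<Sum>j<a. \<Sum>i<j. g i j + g j i)"
    unfolding sum_square_split by (simp add: g_def irrefl)
  also have "\<dots> = (\<Sum>j<a. \<Sum>i\<in>{i\<in>{..<j}. K i j}. edge_weight t s i j)"
  proof (rule sum.cong[OF refl])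
    fix j
    have "g i j + g j i = (if K i j then edge_weight t s i j else 0)" for i
      using sym[of i j] sym[of j i] by (auto simp: g_def edge_weight_def algebra_simps)
    then show "(\<Sum>i<j. g i j + g j i) = (\<Sum>i\<in>{i\<in>{..<j}. K i j}. edge_weight t s i j)"
      by (simp only: sum.inter_filter[OF finite_lessThan])
  qed
  finally show ?thesis by simp
qed

section \<open>The path in natural and in centre-outward order\<close>

definition path_rel :: "nat \<Rightarrow> nat \<Rightarrow> bool" where
  "path_rel i j \<longleftrightarrow> j = Suc i \<or> i = Suc j"

text \<open>The path with its vertices listed from the centre outwards; truncated subtraction
  makes \<open>1\<close> and \<open>2\<close> the neighbours of \<open>0\<close>.\<close>
definition zigzag_rel :: "nat \<Rightarrow> nat \<Rightarrow> bool" where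
  "zigzag_rel i j \<longleftrightarrow> i < j \<and> i = j - 2 \<or> j < i \<and> j = i - 2"

text \<open>The position on the path of entry \<open>j\<close> of the centre-outward list: start at
  \<open>a div 2\<close>, then move alternately to the left and to the right.\<close>

definition zigzag :: "nat \<Rightarrow> nat \<Rightarrow> nat" where
  "zigzag a j = (if even j then a div 2 + j div 2 else a div 2 - 1 - j div 2)"

lemma zigzag_rel_iff: "zigzag_rel i j \<longleftrightarrow> j = i + 2 \<or> i = j + 2 \<or> i = 0 \<and> j = 1 \<or> i = 1 \<and> j = 0"
  unfolding zigzag_rel_def by arith

text \<open>Parity and truncated subtraction are traded for linear equations in \<open>l\<close>,
  which linear arithmetic can handle.\<close>

lemma zigzag_cases:
  assumes "j < a"
  obtains l where "j = 2 * l" "zigzag a j = a div 2 + l"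
  | l where "j = 2 * l + 1" "a div 2 = zigzag a j + l + 1"
proof (cases "even j")
  case True
  then obtain l where "j = 2 * l" by blast
  then show thesis by (intro that(1)[of l]) (simp_all add: zigzag_def)
next
  case False
  then obtain l where "j = 2 * l + 1" by (rule oddE)
  then show thesis using assms by (intro that(2)[of l]) (simp_all add: zigzag_def)
qed

lemma zigzag_less: "j < a \<Longrightarrow> zigzag a j < a"
  by (rule zigzag_cases[of j a]) linarith+

lemma zigzag_inj: "i < a \<Longrightarrow> j < a \<Longrightarrow> zigzag a i = zigzag a j \<Longrightarrow> i = j"
  by (rule zigzag_cases[of i a]; rule zigzag_cases[of j a]) linarith+

lemma bij_zigzag: "bij_betw (zigzag a) {..<a} {..<a}"
proof -
  have "inj_on (zigzag a) {..<a}" by (auto intro!: inj_onI zigzag_inj[of _ a])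
  moreover have "zigzag a ` {..<a} \<subseteq> {..<a}" using zigzag_less by auto
  ultimately show ?thesis by (simp add: bij_betw_def endo_inj_surj)
qed

lemma path_rel_zigzag:
  assumes "i < a" "j < a"
  shows "path_rel (zigzag a i) (zigzag a j) = zigzag_rel i j"
proof -
  define u v b where "u = zigzag a i" and "v = zigzag a j" and "b = a div 2"
  have "(\<exists>l. i = 2 * l \<and> u = b + l) \<or> (\<exists>l. i = 2 * l + 1 \<and> b = u + l + 1)"
    unfolding u_def b_def by (rule zigzag_cases[OF assms(1)]) blast+
  moreover have "(\<exists>l. j = 2 * l \<and> v = b + l) \<or> (\<exists>l. j = 2 * l + 1 \<and> b = v + l + 1)"
    unfolding v_def b_def by (rule zigzag_cases[OF assms(2)]) blast+
  ultimately show ?thesis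
    unfolding path_rel_def zigzag_rel_iff u_def[symmetric] v_def[symmetric]
  proof (elim disjE exE conjE)
    fix l m assume "i = 2 * l" "u = b + l" "j = 2 * m" "v = b + m"
    then show "(v = Suc u \<or> u = Suc v) = (j = i + 2 \<or> i = j + 2 \<or> i = 0 \<and> j = 1 \<or> i = 1 \<and> j = 0)"
      by auto
  next
    fix l m assume "i = 2 * l + 1" "b = u + l + 1" "j = 2 * m + 1" "b = v + m + 1"
    then show "(v = Suc u \<or> u = Suc v) = (j = i + 2 \<or> i = j + 2 \<or> i = 0 \<and> j = 1 \<or> i = 1 \<and> j = 0)"
      by auto
  next
    fix l m assume "i = 2 * l" "u = b + l" "j = 2 * m + 1" "b = v + m + 1"
    moreover from this have "j \<noteq> i + 2" "i \<noteq> j + 2" by presburger+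
    ultimately show "(v = Suc u \<or> u = Suc v) = (j = i + 2 \<or> i = j + 2 \<or> i = 0 \<and> j = 1 \<or> i = 1 \<and> j = 0)"
      by auto
  next
    fix l m assume "i = 2 * l + 1" "b = u + l + 1" "j = 2 * m" "v = b + m"
    moreover from this have "j \<noteq> i + 2" "i \<noteq> j + 2" by presburger+
    ultimately show "(v = Suc u \<or> u = Suc v) = (j = i + 2 \<or> i = j + 2 \<or> i = 0 \<and> j = 1 \<or> i = 1 \<and> j = 0)"
      by auto
  qed
qed

lemma cut_connected_path: "cut_connected {..<a} path_rel"
proof (induction a)
  case 0
  then show ?case by (auto simp: cut_connected_def)
next
  case (Suc a)
  show ?case
  proof (cases "a = 0")
    case True
    then show ?thesis by (auto simp: cut_connected_def)
  next
    case False
    then show ?thesis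
      using cut_connected_insert[OF Suc.IH, of "a - 1" a] by (simp add: path_rel_def lessThan_Suc)
  qed
qed

lemma coupling_path:
  assumes "i < a"
  shows "coupling a path_rel t s i =
    (if i = 0 then 0 else s i + t * s (i - 1)) + (if Suc i < a then s i + t * s (Suc i) else 0)"
proof -
  have "{j. j < a \<and> path_rel i j} = (if i = 0 then {} else {i - 1}) \<union> (if Suc i < a then {Suc i} else {})"
    using assms by (auto simp: path_rel_def)
  then show ?thesis unfolding coupling_def by (auto simp: algebra_simps)
qed

text \<open>At a largest entry there are at most two neighbours, and each contributes at most
  \<open>(1 + t) * s i\<close>. The bound yields both concavity of the eigenvector and the estimate
  of \<open>t - k\<close>.\<close>

lemma coupling_eigenvalue_path_le:
  assumes a: "a > 0" and t: "t > 0" and pos: "\<And>i. i < a \<Longrightarrow> s i > 0"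
    and eig: "\<And>i. i < a \<Longrightarrow> coupling a path_rel t s i = m * s i"
  shows "m \<le> 2 + 2 * t"
proof -
  have "Max (s ` {..<a}) \<in> s ` {..<a}" using a by (intro Max_in) auto
  then obtain i where i: "i < a" "Max (s ` {..<a}) = s i" by auto
  have le: "s j \<le> s i" if "j < a" for j unfolding i(2)[symmetric] using that by (intro Max_ge) auto
  have "s i + t * s j \<le> (1 + t) * s i" if "j < a" for j
    using le[OF that] t by (simp add: distrib_right)
  then have "coupling a path_rel t s i \<le> (1 + t) * s i + (1 + t) * s i"
    unfolding coupling_path[OF i(1)] using i(1) pos[OF i(1)] t
    by (intro add_mono) auto
  then have "m * s i \<le> (2 + 2 * t) * s i" using eig[OF i(1)] by (simp add: algebra_simps)
  then show ?thesis using pos[OF i(1)] by simp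
qed

lemma coupling_path_reverse:
  assumes i: "i < a"
  shows "coupling a path_rel t (\<lambda>i. s (a - 1 - i)) i = coupling a path_rel t s (a - 1 - i)"
proof -
  have "bij_betw (\<lambda>i. a - 1 - i) {..<a} {..<a}"
    by (rule bij_betwI[where g = "\<lambda>i. a - 1 - i"]) auto
  moreover have "path_rel (a - 1 - i) (a - 1 - j) = path_rel i j" if "i < a" "j < a" for i j
    using that unfolding path_rel_def by arith
  ultimately have "coupling a path_rel t s (a - 1 - i) = coupling a path_rel t (s \<circ> (\<lambda>i. a - 1 - i)) i"
    by (rule coupling_relabel[OF _ _ i])
  then show ?thesis by (simp add: comp_def)
qed

lemma coupling_add:
  "coupling a K t (\<lambda>i. x i + y i) i = coupling a K t x i + coupling a K t y i"
  unfolding coupling_def sum.distrib[symmetric] by (intro sum.cong refl) (simp add: algebra_simps)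

text \<open>A symmetric concave sequence increases up to its centre.\<close>
lemma zigzag_decreasing:
  fixes s :: "nat \<Rightarrow> real"
  assumes t: "t > 0" and m: "m \<le> 2 + 2 * t" and pos: "\<And>i. i < a \<Longrightarrow> s i > 0"
    and sym: "\<And>i. i < a \<Longrightarrow> s (a - 1 - i) = s i"
    and eig: "\<And>i. i < a \<Longrightarrow> coupling a path_rel t s i = m * s i"
    and ij: "i \<le> j" "j < a"
  shows "s (zigzag a j) \<le> s (zigzag a i)"
proof -
  have concave: "s (Suc (Suc i)) - s (Suc i) \<le> s (Suc i) - s i" if "Suc (Suc i) < a" for i
  proof -
    have "2 * s (Suc i) + t * (s i + s (Suc (Suc i))) = m * s (Suc i)"
      using eig[of "Suc i"] that by (simp add: coupling_path algebra_simps)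
    also have "\<dots> \<le> (2 + 2 * t) * s (Suc i)" using m pos[of "Suc i"] that by (intro mult_right_mono) auto
    finally have "t * (s i + s (Suc (Suc i))) \<le> t * (2 * s (Suc i))" by (simp add: algebra_simps)
    then show ?thesis using t by simp
  qed
  have anti: "s (Suc (i + d)) - s (i + d) \<le> s (Suc i) - s i" if "Suc (i + d) < a" for i d
    using that
  proof (induction d)
    case (Suc d)
    then show ?case using concave[of "i + d"] by fastforce
  qed simp
  \<comment> \<open>By symmetry the mirrored increment is the negative of this one. It occurs no
    earlier, so it is no larger by \<open>anti\<close>, and hence this increment is
    nonnegative.\<close>
  have incr: "s i \<le> s (Suc i)" if i: "2 * i + 2 \<le> a" for i
  proof -
    obtain d where d: "a = 2 * i + 2 + d" using i by (metis le_Suc_ex)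
    have "s (Suc (i + d)) = s i" "s (i + d) = s (Suc i)"
      using sym[of i] sym[of "Suc i"] d by auto
    then show ?thesis using anti[of i d] d by auto
  qed
  \<comment> \<open>Consecutive zigzag positions are either mirror images, with equal values, or the
    second is the mirror image of a position one step further out than the first. The parities of
    \<open>a\<close> and \<open>j\<close> decide which.\<close>
  have step: "s (zigzag a (Suc j)) \<le> s (zigzag a j)" if j: "Suc j < a" for j
  proof -
    define b where "b = a div 2"
    have ab: "a = 2 * b \<or> a = 2 * b + 1" unfolding b_def by presburger
    show ?thesis
    proof (cases "even j")
      case True
      then obtain l where l: "j = 2 * l" by blast
      have "l + 1 \<le> b" using j l ab by auto
      then have z: "zigzag a j = b + l" "zigzag a (Suc j) = b - 1 - l"
        using l by (auto simp: zigzag_def b_def)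
      show ?thesis
      proof (cases "a = 2 * b")
        case True
        then show ?thesis using sym[of "b + l"] \<open>l + 1 \<le> b\<close> unfolding z by (simp add: algebra_simps)
      next
        case False
        then have "s (b + l) = s (Suc (b - 1 - l))" using sym[of "b + l"] \<open>l + 1 \<le> b\<close> ab
          by (simp add: Suc_diff_Suc)
        then show ?thesis using incr[of "b - 1 - l"] ab \<open>l + 1 \<le> b\<close> unfolding z by auto
      qed
    next
      case False
      then obtain l where l: "j = 2 * l + 1" by (metis oddE)
      have lb: "l + 1 \<le> b" using j l ab by auto
      then have z: "zigzag a j = b - 1 - l" "zigzag a (Suc j) = b + l + 1"
        using l by (auto simp: zigzag_def b_def)
      show ?thesis
      proof (cases "a = 2 * b")
        case True
        then have l2: "l + 2 \<le> b" using j l by auto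
        then have "s (b + l + 1) = s (b - 2 - l)" using sym[of "b + l + 1"] True
          by (simp add: algebra_simps numeral_2_eq_2)
        moreover have "Suc (b - 2 - l) = b - 1 - l" using l2 by auto
        ultimately show ?thesis using incr[of "b - 2 - l"] True l2 unfolding z by auto
      next
        case False
        then have "s (b + l + 1) = s (b - 1 - l)" using sym[of "b + l + 1"] ab lb by simp
        then show ?thesis unfolding z by simp
      qed
    qed
  qed
  show ?thesis using ij
  proof (induction j rule: dec_induct)
    case (step n)
    then show ?case using \<open>\<And>j. Suc j < a \<Longrightarrow> s (zigzag a (Suc j)) \<le> s (zigzag a j)\<close>[of n] by auto
  qed simp
qed

section \<open>Comparing quadratic forms edge by edge\<close>

lemma quadratic_form_zigzag:
  "quadratic_form a (coupling_matrix a zigzag_rel t) s = (\<Sum>j\<in>{0<..<a}. edge_weight t s (j - 2) j)"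
proof -
  \<comment> \<open>For \<open>j = 1\<close> truncated subtraction gives \<open>j - 2 = 0\<close>,
    so every position except the first has exactly one earlier neighbour.\<close>
  have "{i. i < j \<and> zigzag_rel i j} = (if j = 0 then {} else {j - 2})" for j
    by (auto simp: zigzag_rel_def)
  then have "quadratic_form a (coupling_matrix a zigzag_rel t) s = (\<Sum>j<a. if j = 0 then 0 else edge_weight t s (j - 2) j)"
    by (subst quadratic_form_edges) (auto simp: zigzag_rel_def intro!: sum.cong)
  also have "\<dots> = (\<Sum>j\<in>{0<..<a}. if j = 0 then 0 else edge_weight t s (j - 2) j)"
    by (rule sum.mono_neutral_right) auto
  also have "\<dots> = (\<Sum>j\<in>{0<..<a}. edge_weight t s (j - 2) j)" by (rule sum.cong) auto
  finally show ?thesis .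
qed

lemma edge_weight_nonneg: "t \<ge> 0 \<Longrightarrow> s i \<ge> 0 \<Longrightarrow> s j \<ge> 0 \<Longrightarrow> edge_weight t s i j \<ge> 0"
  by (simp add: edge_weight_def)

text \<open>Exchanging one end for a heavier one cannot lower the squares; the gain in the mixed
  term is kept because strictness will rest on it.\<close>

lemma edge_weight_mono:
  assumes "t \<ge> 0" "s j \<ge> 0" "s i \<ge> s l" "s l \<ge> 0"
  shows "edge_weight t s i j \<ge> edge_weight t s l j + 2 * t * s j * (s i - s l)"
  using power_mono[OF assms(3,4), of 2] by (simp add: edge_weight_def algebra_simps)

lemma quadratic_form_ge_parents:
  assumes sym: "\<And>i j. K i j \<Longrightarrow> K j i" and irrefl: "\<And>i. \<not> K i i" and t: "t \<ge> 0"
    and s: "\<And>i. i < a \<Longrightarrow> s i \<ge> 0"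
    and L: "\<And>j. 0 < j \<Longrightarrow> j < a \<Longrightarrow> L j \<subseteq> {i. i < j \<and> K i j}"
  shows "quadratic_form a (coupling_matrix a K t) s \<ge> (\<Sum>j\<in>{0<..<a}. \<Sum>i\<in>L j. edge_weight t s i j)"
proof -
  have "(\<Sum>j\<in>{0<..<a}. \<Sum>i\<in>L j. edge_weight t s i j) \<le> (\<Sum>j\<in>{0<..<a}. \<Sum>i\<in>{i. i < j \<and> K i j}. edge_weight t s i j)"
    using L s t by (intro sum_mono sum_mono2) (auto intro!: edge_weight_nonneg)
  also have "\<dots> = (\<Sum>j<a. \<Sum>i\<in>{i. i < j \<and> K i j}. edge_weight t s i j)"
    by (rule sum.mono_neutral_left) auto
  finally show ?thesis using quadratic_form_edges[of K, OF sym irrefl] by simp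
qed

text \<open>Since \<open>s\<close> is an eigenvector, the form minus \<open>m\<close> times the
  squared norm changes only to second order along \<open>y\<close>. A gain \<open>d * w\<close>
  linear in \<open>d\<close> therefore prevails for small \<open>d\<close>.\<close>

lemma zigzag_perturbation:
  assumes t: "t > 0" and w: "w > 0"
    and eig: "\<And>i. i < a \<Longrightarrow> coupling a zigzag_rel t s i = m * s i"
  obtains d where "d > 0" "quadratic_form a (coupling_matrix a zigzag_rel t) (\<lambda>i. s i + d * y i) + d * w
    > m * sq_norm_upto a (\<lambda>i. s i + d * y i)"
proof -
  let ?B = "coupling_matrix a zigzag_rel t"
  define C where "C = quadratic_form a ?B y - m * sq_norm_upto a y"
  \<comment> \<open>This choice gives \<open>d * C + w = d * (C + \<bar>C\<bar> + 1)\<close>, which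
    is positive for either sign of \<open>C\<close>.\<close>
  define d where "d = w / (\<bar>C\<bar> + 1)"
  have d: "d > 0" "d * (\<bar>C\<bar> + 1) = w" using w by (auto simp: d_def)
  have e0: "quadratic_form a ?B s = m * sq_norm_upto a s"
    unfolding quadratic_form_coupling sq_norm_upto_def sum_distrib_left
    by (intro sum.cong refl) (simp add: eig power2_eq_square)
  have e1: "(\<Sum>i<a. y i * (\<Sum>j<a. ?B i j * s j)) = m * (\<Sum>i<a. y i * s i)"
  proof -
    have "(\<Sum>i<a. y i * (\<Sum>j<a. ?B i j * s j)) = (\<Sum>i<a. m * (y i * s i))"
      by (intro sum.cong refl) (simp add: coupling_matrix_mult eig)
    then show ?thesis by (simp add: sum_distrib_left)
  qed
  have "quadratic_form a ?B (\<lambda>i. s i + d * y i) =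
      quadratic_form a ?B s + 2 * d * (\<Sum>i<a. y i * (\<Sum>j<a. ?B i j * s j)) + d\<^sup>2 * quadratic_form a ?B y"
    by (rule quadratic_form_add) (auto simp: coupling_matrix_def zigzag_rel_def)
  then have "quadratic_form a ?B (\<lambda>i. s i + d * y i) - m * sq_norm_upto a (\<lambda>i. s i + d * y i) = d * (d * C)"
    unfolding sq_norm_upto_add e0 e1 C_def by (simp add: algebra_simps power2_eq_square)
  moreover have "d * C + w > 0"
  proof -
    have "d * (C + \<bar>C\<bar> + 1) > 0" using d by (intro mult_pos_pos) auto
    then show ?thesis using d(2) by (simp add: algebra_simps)
  qed
  then have "d * (d * C + w) > 0" using d by simp
  ultimately show thesis using that[OF d(1)] by (simp add: algebra_simps)
qed

text \<open>Each position \<open>j\<close> has a parent at \<open>j - 2\<close> or earlier, at least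
  as heavy as the zigzag parent, so the form of \<open>K\<close> is no smaller on decreasing
  vectors. A non-zigzag edge makes this strict: it either offers an earlier parent, whose gain a
  small tilt makes positive, or joins \<open>j - 1\<close> to \<open>j\<close> on top of the parent
  edge.\<close>

lemma quadratic_form_gt_zigzag:
  assumes sym: "\<And>i j. K i j \<Longrightarrow> K j i" and irrefl: "\<And>i. \<not> K i i" and t: "t > 0"
    and low: "\<And>j. 0 < j \<Longrightarrow> j < a \<Longrightarrow> \<exists>i\<le>j - 2. K i j"
    and pos: "\<And>i. i < a \<Longrightarrow> s i > 0"
    and dec: "\<And>i j. i \<le> j \<Longrightarrow> j < a \<Longrightarrow> s j \<le> s i"
    and eig: "\<And>i. i < a \<Longrightarrow> coupling a zigzag_rel t s i = m * s i"
    and ne: "i0 < a" "j0 < a" "K i0 j0 \<noteq> zigzag_rel i0 j0"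
  obtains y where "quadratic_form a (coupling_matrix a K t) y > m * sq_norm_upto a y"
proof -
  obtain p where p: "\<And>j. 0 < j \<Longrightarrow> j < a \<Longrightarrow> p j \<le> j - 2 \<and> K (p j) j"
    using low by metis
  \<comment> \<open>If all edges joined \<open>j - 2\<close> to \<open>j\<close>, then every parent
    would have to be \<open>j - 2\<close>, and \<open>K\<close> would be the zigzag.\<close>
  have "\<exists>i j. i < j \<and> j < a \<and> K i j \<and> i \<noteq> j - 2"
  proof (rule ccontr)
    assume "\<not> ?thesis"
    then have 1: "i = j - 2" if "i < j" "j < a" "K i j" for i j using that by blast
    have 2: "K (j - 2) j" if "0 < j" "j < a" for j
    proof -
      have "p j < j" using p[OF that] that by linarith
      then show ?thesis using p[OF that] 1[of "p j" j] that by metis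
    qed
    have "K i j = zigzag_rel i j" if "i < j" "j < a" for i j
      using that 1[of i j] 2[of j] by (auto simp: zigzag_rel_def)
    moreover have "zigzag_rel i j = zigzag_rel j i" for i j by (auto simp: zigzag_rel_def)
    moreover have "K i j = K j i" for i j using sym by blast
    moreover have "K i i = zigzag_rel i i" for i by (simp add: irrefl zigzag_rel_def)
    ultimately show False using ne by (metis nat_neq_iff)
  qed
  then obtain i j where ij: "i < j" "j < a" "K i j" "i \<noteq> j - 2" by blast
  have j: "0 < j" using ij by simp
  consider "i < j - 2" | "i = j - 1" "j \<ge> 2" using ij by linarith
  then show thesis
  proof cases
    case 1
    \<comment> \<open>A positive, strictly decreasing tilt: even where \<open>s\<close> has ties,
      \<open>i\<close> exceeds \<open>j - 2\<close> by at least \<open>d\<close> after the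
      perturbation. The edge at \<open>j\<close> thus gains at least
      \<open>d * (2 * t * s j)\<close>, linear in \<open>d\<close>.\<close>
    define y where "y l = real a - real l" for l
    have "2 * t * s j > 0" using t pos[OF ij(2)] by simp
    from zigzag_perturbation[OF t this eig, where y = y] obtain d where d: "d > 0"
      "quadratic_form a (coupling_matrix a zigzag_rel t) (\<lambda>l. s l + d * y l) + d * (2 * t * s j)
        > m * sq_norm_upto a (\<lambda>l. s l + d * y l)" by metis
    define x where "x l = s l + d * y l" for l
    have xpos: "x l \<ge> s l" if "l < a" for l using that d(1) by (simp add: x_def y_def)
    then have x0: "x l \<ge> 0" if "l < a" for l using that pos[OF that] by (meson less_imp_le order_trans)
    have xdec: "x l' + d * (real l' - real l) \<le> x l" if "l \<le> l'" "l' < a" for l l'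
      using dec[OF that] by (simp add: x_def y_def algebra_simps)
    have xdec': "x l' \<le> x l" if "l \<le> l'" "l' < a" for l l'
    proof -
      have "d * (real l' - real l) \<ge> 0" using that d(1) by simp
      then show ?thesis using xdec[OF that] by linarith
    qed
    define q where "q l = (if l = j then i else p l)" for l
    have "(\<Sum>l\<in>{0<..<a}. edge_weight t x (l - 2) l + (if l = j then d * (2 * t * s j) else 0))
        \<le> (\<Sum>l\<in>{0<..<a}. \<Sum>h\<in>{q l}. edge_weight t x h l)"
    proof (rule sum_mono)
      fix l assume "l \<in> {0<..<a}"
      then have l: "0 < l" "l < a" by auto
      have ql: "q l \<le> l - 2" using p[OF l] 1 by (simp add: q_def)
      have l2: "l - 2 < a" using l by simp
      have "edge_weight t x (q l) l \<ge> edge_weight t x (l - 2) l + 2 * t * x l * (x (q l) - x (l - 2))"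
        using t l l2 ql x0 xdec' by (intro edge_weight_mono) auto
      moreover have "2 * t * x l * (x (q l) - x (l - 2)) \<ge> (if l = j then d * (2 * t * s j) else 0)"
      proof (cases "l = j")
        case True
        have "d * 1 \<le> d * (real (j - 2) - real i)" using d(1) 1 by (intro mult_left_mono) auto
        then have "x (q l) - x (l - 2) \<ge> d" using xdec[OF ql l2] True by (simp add: q_def)
        moreover have "x l \<ge> s j" using xpos[OF l(2)] True by simp
        ultimately have "x l * (x (q l) - x (l - 2)) \<ge> s j * d"
          using pos[OF ij(2)] d(1) by (intro mult_mono) auto
        then have "2 * t * (x l * (x (q l) - x (l - 2))) \<ge> 2 * t * (s j * d)"
          using t by (intro mult_left_mono) auto
        then show ?thesis using True by (simp add: algebra_simps)
      next
        case False
        then show ?thesis using t x0[OF l(2)] xdec'[OF ql l2] by simp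
      qed
      ultimately show "edge_weight t x (l - 2) l + (if l = j then d * (2 * t * s j) else 0)
          \<le> (\<Sum>h\<in>{q l}. edge_weight t x h l)" by simp
    qed
    also have "\<dots> \<le> quadratic_form a (coupling_matrix a K t) x"
    proof (rule quadratic_form_ge_parents[OF sym irrefl])
      fix l assume l: "0 < l" "l < a"
      have "p l < l" using p[OF l] l by linarith
      then show "{q l} \<subseteq> {i. i < l \<and> K i l}" using p[OF l] ij by (auto simp: q_def)
    qed (use t x0 in auto)
    finally have "quadratic_form a (coupling_matrix a zigzag_rel t) x + d * (2 * t * s j)
        \<le> quadratic_form a (coupling_matrix a K t) x"
      using j ij(2) by (simp add: sum.distrib quadratic_form_zigzag)
    then show thesis using d(2) that[of x] unfolding x_def[abs_def] by linarith
  next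
    case 2
    have s0: "\<And>l. l < a \<Longrightarrow> s l \<ge> 0" using pos by (simp add: less_imp_le)
    \<comment> \<open>Here \<open>i = j - 1\<close> lies after every admissible parent of
      \<open>j\<close>, so its edge is an additional one and no perturbation of \<open>s\<close> is
      required.\<close>
    define L where "L l = (if l = j then {p l, i} else {p l})" for l
    have "p j \<noteq> i" using p[OF j ij(2)] 2 by auto
    have wpos: "edge_weight t s i j > 0"
      using pos[of i] pos[of j] ij t by (auto simp: edge_weight_def intro!: add_pos_pos)
    have e0: "quadratic_form a (coupling_matrix a zigzag_rel t) s = m * sq_norm_upto a s"
      unfolding quadratic_form_coupling sq_norm_upto_def sum_distrib_left
      by (intro sum.cong refl) (simp add: eig power2_eq_square)
    have "(\<Sum>l\<in>{0<..<a}. edge_weight t s (l - 2) l + (if l = j then edge_weight t s i j else 0))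
        \<le> (\<Sum>l\<in>{0<..<a}. \<Sum>h\<in>L l. edge_weight t s h l)"
    proof (rule sum_mono)
      fix l assume "l \<in> {0<..<a}"
      then have l: "0 < l" "l < a" by auto
      have pl: "p l \<le> l - 2" using p[OF l] by simp
      have "edge_weight t s (p l) l \<ge> edge_weight t s (l - 2) l + 2 * t * s l * (s (p l) - s (l - 2))"
        using t l pl s0 dec by (intro edge_weight_mono) auto
      moreover have "2 * t * s l * (s (p l) - s (l - 2)) \<ge> 0"
        using t s0[OF l(2)] dec[OF pl] l by simp
      ultimately show "edge_weight t s (l - 2) l + (if l = j then edge_weight t s i j else 0)
          \<le> (\<Sum>h\<in>L l. edge_weight t s h l)"
        using \<open>p j \<noteq> i\<close> by (auto simp: L_def)
    qed
    also have "\<dots> \<le> quadratic_form a (coupling_matrix a K t) s"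
    proof (rule quadratic_form_ge_parents[OF sym irrefl])
      fix l assume l: "0 < l" "l < a"
      have "p l < l" using p[OF l] l by linarith
      then show "L l \<subseteq> {i. i < l \<and> K i l}" using p[OF l] ij by (auto simp: L_def)
    qed (use t s0 in auto)
    finally have "quadratic_form a (coupling_matrix a zigzag_rel t) s + edge_weight t s i j
        \<le> quadratic_form a (coupling_matrix a K t) s"
      using j ij(2) by (simp add: sum.distrib quadratic_form_zigzag)
    then show thesis using wpos e0 that[of s] by linarith
  qed
qed

text \<open>A vector with a large Rayleigh quotient need not satisfy the inequality row by row. It
  is replaced by the nonnegative top eigenvector, whose eigenvalue is at least as large and which
  can be lifted.\<close>

lemma coupling_subsolution_of_not_zigzag:
  assumes sym: "\<And>i j. K i j \<Longrightarrow> K j i" and irrefl: "\<And>i. \<not> K i i" and t: "t > 0"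
    and low: "\<And>j. 0 < j \<Longrightarrow> j < a \<Longrightarrow> \<exists>i\<le>j - 2. K i j"
    and pos: "\<And>i. i < a \<Longrightarrow> s i > 0"
    and dec: "\<And>i j. i \<le> j \<Longrightarrow> j < a \<Longrightarrow> s j \<le> s i"
    and eig: "\<And>i. i < a \<Longrightarrow> coupling a zigzag_rel t s i = m * s i"
    and ne: "i0 < a" "j0 < a" "K i0 j0 \<noteq> zigzag_rel i0 j0"
  obtains r x where "r > m" "\<And>i. x i \<ge> 0" "\<exists>i<a. x i > 0" "\<And>i. i < a \<Longrightarrow> coupling a K t x i = r * x i"
proof -
  obtain y where y: "quadratic_form a (coupling_matrix a K t) y > m * sq_norm_upto a y"
    using quadratic_form_gt_zigzag[OF sym irrefl t low pos dec eig ne] by metis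
  have a: "a > 0" using ne by simp
  have Bsym: "coupling_matrix a K t i j = coupling_matrix a K t j i" for i j
    using sym[of i j] sym[of j i] by (auto simp: coupling_matrix_def)
  have Bnonneg: "coupling_matrix a K t i j \<ge> 0" for i j using t by (simp add: coupling_matrix_def)
  obtain r x where rx: "\<And>i. x i \<ge> 0" "\<exists>i<a. x i > 0"
    "\<And>i. i < a \<Longrightarrow> (\<Sum>j<a. coupling_matrix a K t i j * x j) = r * x i"
    "\<And>y. quadratic_form a (coupling_matrix a K t) y \<le> r * sq_norm_upto a y"
    by (rule symmetric_nonneg_top_eigenvector[of a "coupling_matrix a K t", OF a Bsym Bnonneg]) blast
  have "m * sq_norm_upto a y < r * sq_norm_upto a y" using y rx(4)[of y] by linarith
  then have "m < r" using sq_norm_upto_nonneg[of a y] by (simp add: mult_less_cancel_right)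
  moreover have "coupling a K t x i = r * x i" if "i < a" for i
    using rx(3)[OF that] by (simp add: coupling_matrix_mult[OF that])
  ultimately show thesis using that rx(1,2) by blast
qed

section \<open>Clique paths\<close>

lemma coupling_cong:
  assumes "\<And>j. j < a \<Longrightarrow> K i j = K' i j"
  shows "coupling a K t s i = coupling a K' t s i"
  unfolding coupling_def using assms by (intro sum.cong) auto

text \<open>An edge from the support to a vertex \<open>y\<close> with \<open>s y = 0\<close> would
  make the coupling at \<open>y\<close> positive, although it equals \<open>m * s y = 0\<close>. So
  the support is everything.\<close>

lemma coupling_eigenvector_pos:
  assumes con: "cut_connected {..<a} K" and sym: "\<And>i j. K i j \<Longrightarrow> K j i" and t: "t > 0"
    and nonneg: "\<And>i. i < a \<Longrightarrow> s i \<ge> 0" and ex: "\<exists>i<a. s i > 0"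
    and eig: "\<And>i. i < a \<Longrightarrow> coupling a K t s i = m * s i"
    and i: "i < a"
  shows "s i > 0"
proof -
  define A where "A = {i. i < a \<and> s i > 0}"
  have "A = {..<a}"
  proof (rule ccontr)
    assume "A \<noteq> {..<a}"
    moreover have "A \<subseteq> {..<a}" "A \<noteq> {}" using ex by (auto simp: A_def)
    ultimately obtain x y where xy: "x \<in> A" "y \<in> {..<a} - A" "K x y"
      using con unfolding cut_connected_def by metis
    have y: "y < a" "s y = 0" using xy(2) nonneg[of y] by (auto simp: A_def)
    have x: "x < a" "s x > 0" using xy(1) by (auto simp: A_def)
    have "0 < s y + t * s x" using x y t by simp
    also have "\<dots> \<le> coupling a K t s y"
      unfolding coupling_def using x y t nonneg sym[OF xy(3)] by (intro member_le_sum) auto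
    finally show False using eig[OF y(1)] y(2) by simp
  qed
  then show ?thesis using i by (auto simp: A_def)
qed

text \<open>Used to number a block so that its left attachment vertex comes first and its right one
  last, as in the clique path.\<close>

lemma inj_on_with_prescribed_ends:
  assumes B: "finite B" "card B = k" "x \<in> B" "y \<in> B" "x \<noteq> y"
  obtains g where "inj_on g B" "\<And>v. v \<in> B \<Longrightarrow> g v < k" "g x = 0" "g y = k - (1::nat)"
proof -
  have c2: "card {x, y} = 2" "{x, y} \<subseteq> B" using B by auto
  then have k: "k \<ge> 2" using card_mono[OF B(1) c2(2)] B(2) by simp
  have "card (B - {x, y}) = card {1..<k - 1}"
    using B c2 by (subst card_Diff_subset) auto
  then obtain h where h: "bij_betw h (B - {x, y}) {1..<k - 1}"
    using B(1) by (metis finite_Diff finite_atLeastLessThan finite_same_card_bij)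
  define g where "g v = (if v = x then 0 else if v = y then k - 1 else h v)" for v
  have hr: "1 \<le> h v \<and> h v < k - 1" if "v \<in> B" "v \<noteq> x" "v \<noteq> y" for v
    using bij_betwE[OF h] that by auto
  have hi: "u = v" if "u \<in> B" "u \<noteq> x" "u \<noteq> y" "v \<in> B" "v \<noteq> x" "v \<noteq> y" "h u = h v" for u v
    using bij_betw_imp_inj_on[OF h] that by (auto dest: inj_onD)
  have "inj_on g B"
  proof (rule inj_onI)
    fix u v assume uv: "u \<in> B" "v \<in> B" "g u = g v"
    show "u = v"
      using uv hi[of u v] hr[of u] hr[of v] k by (auto simp: g_def split: if_splits)
  qed
  moreover have "g v < k" if "v \<in> B" for v using hr[OF that] k by (auto simp: g_def)
  ultimately show thesis using B(5) by (intro that[of g]) (auto simp: g_def)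
qed

context clique_blocks
begin

text \<open>Blocks are numbered along the path and vertices within each block from the left to the
  right attachment vertex. Exactness ensures that the cross edges are just those of the clique
  path.\<close>

lemma graph_iso_clique_path:
  assumes n: "n = k * a" and k: "k \<ge> 2" and p: "exact_attachment p"
    and Q: "\<And>i j. i < a \<Longrightarrow> j < a \<Longrightarrow> quotient i j = path_rel i j"
  shows "graph_iso n E (clique_path k a)"
proof -
  have att: "E (p i j) (p j i)" "c (p i j) = i" "p i j < n" if "quotient i j" for i j
    using p that edgeD unfolding exact_attachment_def attachment_def by blast+
  have inj_p: "j = l" if "quotient i j" "quotient i l" "p i j = p i l" for i j l
    using p that unfolding exact_attachment_def by blast
  have exact: "p (c u) (c v) = u" if "E u v" "c u \<noteq> c v" for u v
    using p that unfolding exact_attachment_def by blast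
  \<comment> \<open>At an end of the path one attachment vertex is missing; any other vertex of the
    block replaces it, and \<open>k \<ge> 2\<close> provides one.\<close>
  have "\<exists>x y. x \<in> block i \<and> y \<in> block i \<and> x \<noteq> y \<and>
      (0 < i \<longrightarrow> x = p i (i - 1)) \<and> (Suc i < a \<longrightarrow> y = p i (Suc i))" if i: "i < a" for i
  proof -
    have other: "\<exists>y\<in>block i. y \<noteq> x" for x
    proof (rule ccontr)
      assume "\<not> ?thesis"
      then have "block i \<subseteq> {x}" by blast
      then have "card (block i) \<le> 1" by (metis card_mono finite.emptyI finite_insert is_singletonI is_singleton_altdef)
      then show False using i k by simp
    qed
    have l: "p i (i - 1) \<in> block i" if "0 < i"
      using Q[OF i, of "i - 1"] that i att[of i "i - 1"] by (simp add: path_rel_def block_def)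
    have r: "p i (Suc i) \<in> block i" if "Suc i < a"
      using Q[OF i, of "Suc i"] that att[of i "Suc i"] by (simp add: path_rel_def block_def)
    have lr: "p i (i - 1) \<noteq> p i (Suc i)" if "0 < i" "Suc i < a"
      using Q[OF i, of "i - 1"] Q[OF i, of "Suc i"] that i inj_p[of i "i - 1" "Suc i"] by (auto simp: path_rel_def)
    show ?thesis
    proof (cases "0 < i"; cases "Suc i < a")
      assume "0 < i" "Suc i < a"
      then show ?thesis using l r lr by blast
    next
      assume *: "0 < i" "\<not> Suc i < a"
      obtain y where "y \<in> block i" "y \<noteq> p i (i - 1)" using other by blast
      then show ?thesis using l * by metis
    next
      assume *: "\<not> 0 < i" "Suc i < a"
      obtain x where "x \<in> block i" "x \<noteq> p i (Suc i)" using other by blast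
      then show ?thesis using r * by metis
    next
      assume *: "\<not> 0 < i" "\<not> Suc i < a"
      obtain x where x: "x \<in> block i" using other by blast
      obtain y where "y \<in> block i" "y \<noteq> x" using other by blast
      then show ?thesis using x * by metis
    qed
  qed
  then obtain x y where xy: "\<And>i. i < a \<Longrightarrow> x i \<in> block i \<and> y i \<in> block i \<and> x i \<noteq> y i \<and>
      (0 < i \<longrightarrow> x i = p i (i - 1)) \<and> (Suc i < a \<longrightarrow> y i = p i (Suc i))"
    by metis
  have "\<exists>g. inj_on g (block i) \<and> (\<forall>v\<in>block i. g v < k) \<and> g (x i) = 0 \<and> g (y i) = k - 1" if i: "i < a" for i
    using inj_on_with_prescribed_ends[OF finite_block card_block'[OF i], of "x i" "y i"] xy[OF i] by metis
  then obtain g where g: "\<And>i. i < a \<Longrightarrow>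
      inj_on (g i) (block i) \<and> (\<forall>v\<in>block i. g i v < k) \<and> g i (x i) = 0 \<and> g i (y i) = k - 1"
    by metis
  define f where "f v = c v * k + g (c v) v" for v
  have gl: "g (c v) v < k" if "v < n" for v
    using g[OF colour_less[OF that]] that by (auto simp: block_def)
  have fdiv: "f v div k = c v" and fmod: "f v mod k = g (c v) v" if "v < n" for v
    using gl[OF that] k by (auto simp: f_def)
  have g_inj: "u = v" if "u < n" "v < n" "c u = c v" "g (c u) u = g (c v) v" for u v
  proof -
    have "inj_on (g (c u)) (block (c u))" "u \<in> block (c u)" "v \<in> block (c u)"
      using g[OF colour_less[OF that(1)]] that by (simp_all add: block_def)
    then show ?thesis using that(3,4) by (simp add: inj_on_eq_iff)
  qed
  have f_inj: "u = v" if "u < n" "v < n" "f u = f v" for u v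
    using that fdiv[OF that(1)] fdiv[OF that(2)] fmod[OF that(1)] fmod[OF that(2)] g_inj[OF that(1,2)] by simp
  have f_less: "f v < n" if "v < n" for v
  proof -
    have "f v < (c v + 1) * k" using gl[OF that] by (simp add: f_def)
    also have "\<dots> \<le> a * k" using colour_less[OF that] by (intro mult_right_mono) auto
    finally show ?thesis by (simp add: n mult.commute)
  qed
  have "inj_on f {0..<n}" using f_inj by (auto intro: inj_onI)
  moreover have "f ` {0..<n} \<subseteq> {0..<n}" using f_less by auto
  ultimately have bij: "bij_betw f {0..<n} {0..<n}" by (simp add: bij_betw_def endo_inj_surj)
  have x_iff: "g (c v) v = 0 \<longleftrightarrow> v = x (c v)" and y_iff: "g (c v) v = k - 1 \<longleftrightarrow> v = y (c v)" if v: "v < n" for v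
  proof -
    note cv = colour_less[OF v]
    have "x (c v) < n" "c (x (c v)) = c v" "y (c v) < n" "c (y (c v)) = c v"
      using xy[OF cv] by (auto simp: block_def)
    then show "g (c v) v = 0 \<longleftrightarrow> v = x (c v)" "g (c v) v = k - 1 \<longleftrightarrow> v = y (c v)"
      using g[OF cv] g_inj[OF v] by metis+
  qed
  \<comment> \<open>Consecutive numbers across a block boundary belong to the last vertex of one
    block and the first of the next, that is, to the two ends of the selected edge.\<close>
  have forward: "f v = f u + 1 \<and> f v mod k = 0 \<longleftrightarrow> c v = Suc (c u) \<and> E u v"
    if u: "u < n" and v: "v < n" and ne: "c u \<noteq> c v" for u v
  proof
    assume *: "f v = f u + 1 \<and> f v mod k = 0"
    then have gv: "g (c v) v = 0" using fmod[OF v] by simp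
    then have e: "c v * k = c u * k + g (c u) u + 1" using * by (simp add: f_def)
    have "c v * k \<le> (c u + 1) * k" using e gl[OF u] by simp
    then have "c v \<le> c u + 1" using k by (metis mult_le_cancel2 not_numeral_le_zero gr_zeroI)
    moreover have "c u * k < c v * k" using e by simp
    then have "c u < c v" by simp
    ultimately have cv: "c v = Suc (c u)" by simp
    then have "g (c u) u = k - 1" using e by simp
    then have uv: "u = y (c u)" "v = x (c v)" using gv x_iff[OF v] y_iff[OF u] by auto
    have sa: "Suc (c u) < a" using colour_less[OF v] cv by simp
    have "u = p (c u) (c v)" "v = p (c v) (c u)"
      using uv xy[OF colour_less[OF u]] xy[OF colour_less[OF v]] sa cv by auto
    moreover have "quotient (c u) (c v)"
      using Q[OF colour_less[OF u] colour_less[OF v]] cv by (simp add: path_rel_def)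
    ultimately show "c v = Suc (c u) \<and> E u v" using att(1)[of "c u" "c v"] cv by metis
  next
    assume *: "c v = Suc (c u) \<and> E u v"
    then have uv: "u = p (c u) (c v)" "v = p (c v) (c u)"
      using exact[of u v] exact[of v u] ne edgeD by metis+
    have sa: "Suc (c u) < a" using colour_less[OF v] * by simp
    have "u = y (c u)" "v = x (c v)"
      using uv xy[OF colour_less[OF u]] xy[OF colour_less[OF v]] sa * by auto
    then have "g (c u) u = k - 1" "g (c v) v = 0" using x_iff[OF v] y_iff[OF u] by auto
    then show "f v = f u + 1 \<and> f v mod k = 0" using * k by (simp add: f_def)
  qed
  have "E u v \<longleftrightarrow> clique_path k a (f u) (f v)" if u: "u < n" and v: "v < n" for u v
  proof (cases "c u = c v")
    case True
    have "clique_path k a (f u) (f v) \<longleftrightarrow> u \<noteq> v"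
      using f_inj[OF u v] f_less[OF u] f_less[OF v] fdiv[OF u] fdiv[OF v] True
      unfolding clique_path_def n[symmetric] by auto
    then show ?thesis using clique[OF u v _ True] edgeD by blast
  next
    case False
    have "E u v \<longleftrightarrow> (c v = Suc (c u) \<and> E u v) \<or> (c u = Suc (c v) \<and> E v u)"
    proof -
      have "path_rel (c u) (c v)" if "E u v"
        using Q[OF colour_less[OF u] colour_less[OF v]] that False unfolding quotient_def by blast
      then show ?thesis using edgeD[of u v] edgeD[of v u] by (auto simp: path_rel_def)
    qed
    also have "\<dots> \<longleftrightarrow> (f v = f u + 1 \<and> f v mod k = 0) \<or> (f u = f v + 1 \<and> f u mod k = 0)"
      by (simp only: forward[OF u v False] forward[OF v u False[symmetric]])
    also have "\<dots> \<longleftrightarrow> clique_path k a (f u) (f v)"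
    proof -
      have "f u \<noteq> f v" using f_inj[OF u v] False by blast
      then show ?thesis
        unfolding clique_path_def n[symmetric] using f_less[OF u] f_less[OF v] fdiv[OF u] fdiv[OF v] False by simp
    qed
    finally show ?thesis .
  qed
  then show ?thesis using bij unfolding graph_iso_def by blast
qed

end

lemma simple_graph_clique_path: "simple_graph (k * a) (clique_path k a)"
  by (auto simp: simple_graph_def clique_path_def)

lemma clique_blocks_clique_path:
  assumes k: "k \<ge> 2"
  shows "clique_blocks (k * a) k a (clique_path k a) (\<lambda>v. v div k)"
proof
  show "v div k < a" if "v < k * a" for v using that k by (simp add: div_less_iff_less_mult mult.commute)
  show "card {v. v < k * a \<and> v div k = i} = k" if i: "i < a" for i
  proof -
    have "{v. v < k * a \<and> v div k = i} = {i * k..<i * k + k}"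
    proof (intro equalityI subsetI)
      fix v assume "v \<in> {v. v < k * a \<and> v div k = i}"
      then show "v \<in> {i * k..<i * k + k}" using k div_mult_mod_eq[of v k] mod_less_divisor[of k v]
        by (simp, linarith)
    next
      fix v assume v: "v \<in> {i * k..<i * k + k}"
      then have "v div k = i" by (intro div_nat_eqI) (auto simp: mult.commute)
      moreover have "(i + 1) * k \<le> a * k" using i by (intro mult_right_mono) auto
      ultimately show "v \<in> {v. v < k * a \<and> v div k = i}" using v by (simp add: mult.commute)
    qed
    then show ?thesis by simp
  qed
qed (auto simp: simple_graph_clique_path clique_path_def)

lemma clique_path_cross_edge:
  assumes k: "k \<ge> 2" and e: "clique_path k a u v" "u div k \<noteq> v div k"
  shows "v div k = Suc (u div k) \<and> u = u div k * k + k - 1 \<and> v = v div k * k \<or>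
    u div k = Suc (v div k) \<and> v = v div k * k + k - 1 \<and> u = u div k * k"
proof -
  have *: "y div k = Suc (x div k) \<and> x = x div k * k + k - 1 \<and> y = y div k * k"
    if "y = x + 1" "y mod k = 0" for x y
  proof -
    have y: "y = y div k * k" using that(2) div_mult_mod_eq[of y k] by simp
    have "0 < y div k" using y that(1) by (metis add_is_0 gr_zeroI mult_0 one_neq_zero)
    then obtain q where q: "y div k = Suc q" using gr0_implies_Suc by blast
    have x: "x = q * k + (k - 1)" using y that(1) k unfolding q by simp
    have "x div k = q" unfolding x by (rule div_nat_eqI) (use k in \<open>simp_all add: mult.commute\<close>)
    then show ?thesis using x y q k by simp
  qed
  consider "v = u + 1" "v mod k = 0" | "u = v + 1" "u mod k = 0"
    using e unfolding clique_path_def by auto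
  then show ?thesis
  proof cases
    case 1
    then show ?thesis using *[OF 1] by blast
  next
    case 2
    then show ?thesis using *[OF 2] by blast
  qed
qed

lemma clique_path_edge:
  assumes k: "k \<ge> 2" and i: "Suc i < a"
  shows "clique_path k a (i * k + k - 1) (Suc i * k)"
proof -
  have "Suc (Suc i) * k \<le> a * k" using i by (intro mult_right_mono) auto
  then have less: "Suc i * k + k \<le> k * a" by (simp add: mult.commute)
  define u v where "u = i * k + k - 1" and "v = Suc i * k"
  have "v = u + 1" using k by (simp add: u_def v_def)
  moreover have "v < k * a" using less k unfolding v_def by linarith
  moreover have "v mod k = 0" by (simp add: v_def)
  ultimately have "clique_path k a u v" unfolding clique_path_def by simp
  then show ?thesis by (simp only: u_def v_def)
qed

lemma quotient_clique_path:
  assumes k: "k \<ge> 2" and ij: "i < a" "j < a"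
  shows "clique_blocks.quotient (clique_path k a) (\<lambda>v. v div k) i j = path_rel i j"
proof -
  interpret P: clique_blocks "k * a" k a "clique_path k a" "\<lambda>v. v div k"
    by (rule clique_blocks_clique_path[OF k])
  have ends: "(i * k + k - 1) div k = i" "(i * k) div k = i" for i
    using k by (auto intro!: div_nat_eqI simp: mult.commute)
  have *: "P.quotient i (Suc i)" if "Suc i < a" for i
    using clique_path_edge[OF k that] ends[of i] ends[of "Suc i"] unfolding P.quotient_def by (metis n_not_Suc_n)
  show ?thesis
  proof
    assume "P.quotient i j"
    then show "path_rel i j" using clique_path_cross_edge[OF k] unfolding P.quotient_def path_rel_def by metis
  next
    assume "path_rel i j"
    then show "P.quotient i j" using * P.quotient_sym ij unfolding path_rel_def by blast
  qed
qed

lemma exact_attachment_clique_path: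
  assumes k: "k \<ge> 2"
  shows "clique_blocks.exact_attachment (clique_path k a) (\<lambda>v. v div k)
    (\<lambda>i j. if i < j then i * k + k - 1 else i * k)"
proof -
  interpret P: clique_blocks "k * a" k a "clique_path k a" "\<lambda>v. v div k"
    by (rule clique_blocks_clique_path[OF k])
  have ends: "(i * k + k - 1) div k = i" "(i * k) div k = i" for i
    using k by (auto intro!: div_nat_eqI simp: mult.commute)
  have q: "i < a \<and> j < a \<and> (j = Suc i \<or> i = Suc j)" if "P.quotient i j" for i j
    using quotient_clique_path[OF k] P.quotient_less[OF that] that by (auto simp: path_rel_def)
  define p where "p i j = (if i < j then i * k + k - 1 else i * k)" for i j
  have "P.attachment p"
    unfolding P.attachment_def
  proof (intro allI impI)
    fix i j assume "P.quotient i j"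
    then consider "j < a" "j = Suc i" | "i < a" "i = Suc j" using q by blast
    then show "clique_path k a (p i j) (p j i) \<and> p i j div k = i"
    proof cases
      case 1
      then show ?thesis using clique_path_edge[OF k, of i a] ends(1)[of i] by (simp add: p_def)
    next
      case 2
      then show ?thesis using P.edgeD[OF clique_path_edge[OF k, of j a]] ends(2)[of i] by (simp add: p_def)
    qed
  qed
  moreover have "j = l" if "P.quotient i j" "P.quotient i l" "p i j = p i l" for i j l
  proof -
    have "i * k + k - 1 \<noteq> i * k" using k by simp
    then show ?thesis using q[OF that(1)] q[OF that(2)] that(3) by (auto simp: p_def split: if_splits)
  qed
  moreover have "p (u div k) (v div k) = u" if "clique_path k a u v" "u div k \<noteq> v div k" for u v
    using clique_path_cross_edge[OF k that] by (auto simp: p_def)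
  ultimately show ?thesis unfolding P.exact_attachment_def p_def by blast
qed

text \<open>Block sums of a Perron vector satisfy the coupling equation and are positive because the
  path is connected. Adding the reversed sequence makes them symmetric.\<close>

lemma clique_path_eigensystem:
  assumes k: "k \<ge> 2" and a: "a > 0" and t: "t = graph_spectral_radius (k * a) (clique_path k a) + 1"
  obtains s where "\<And>i. i < a \<Longrightarrow> s i > 0" "\<And>i. i < a \<Longrightarrow> s (a - 1 - i) = s i"
    "\<And>i. i < a \<Longrightarrow> coupling a path_rel t s i = (t - k) * (t\<^sup>2 - 1) * s i"
    and "t \<ge> k" "(t - k) * (t - 1) \<le> 2"
proof -
  interpret P: clique_blocks "k * a" k a "clique_path k a" "\<lambda>v. v div k"
    by (rule clique_blocks_clique_path[OF k])
  have n: "k * a > 0" using k a by simp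
  have "P.block 0 \<noteq> {}" using P.card_block'[OF a] k by force
  then have "real (card (P.block 0)) - 1 \<le> graph_spectral_radius (k * a) (clique_path k a)"
    by (intro graph_spectral_radius_ge_clique P.graph) (auto simp: P.block_def intro: P.clique)
  then have tk: "t \<ge> k" using t P.card_block'[OF a] by simp
  then have t1: "t > 1" using k by simp
  obtain x where x: "\<And>i. x i \<ge> 0" "\<exists>i<k * a. x i > 0"
    "\<And>i. i < k * a \<Longrightarrow> (\<Sum>j<k * a. adj (clique_path k a) i j * x j) = graph_spectral_radius (k * a) (clique_path k a) * x i"
    by (rule graph_perron[OF n P.graph]) blast
  define S where "S i = (\<Sum>v\<in>P.block i. x v)" for i
  have eigP: "coupling a path_rel t S i = (t - k) * (t\<^sup>2 - 1) * S i" if i: "i < a" for i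
  proof -
    have "coupling a P.quotient t S i = (t - k) * (t\<^sup>2 - 1) * S i"
      unfolding S_def
      by (rule P.block_sums_of_eigenvector[OF exact_attachment_clique_path[OF k] t1 _ i])
         (use x(3) in \<open>simp add: t sum_adj\<close>)
    then show ?thesis using coupling_cong[of a P.quotient i path_rel] quotient_clique_path[OF k i] by simp
  qed
  have S0: "S i \<ge> 0" for i unfolding S_def using x(1) by (simp add: sum_nonneg)
  have "\<exists>i<a. S i > 0"
  proof -
    obtain v where v: "v < k * a" "x v > 0" using x(2) by blast
    have "x v \<le> S (v div k)"
      unfolding S_def using x(1) v by (intro member_le_sum) (auto simp: P.block_def)
    then show ?thesis using v P.colour_less[OF v(1)] by force
  qed
  then have Spos: "S i > 0" if "i < a" for i
    using coupling_eigenvector_pos[OF cut_connected_path _ _ S0 _ eigP that] t1 by (auto simp: path_rel_def)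
  have "(t - k) * (t\<^sup>2 - 1) \<le> 2 + 2 * t"
    using coupling_eigenvalue_path_le[OF a _ Spos eigP] t1 by simp
  \<comment> \<open>Cancelling \<open>t + 1\<close> leaves the bound showing that \<open>t\<close>
    exceeds \<open>k\<close> only slightly.\<close>
  then have "(t - k) * (t - 1) * (t + 1) \<le> 2 * (t + 1)" by (simp add: algebra_simps power2_eq_square)
  then have m2: "(t - k) * (t - 1) \<le> 2" by (rule mult_right_le_imp_le) (use t1 in simp)
  define s where "s i = S i + S (a - 1 - i)" for i
  show thesis
  proof (rule that[of s])
    fix i assume i: "i < a"
    then have i': "a - 1 - i < a" "a - 1 - (a - 1 - i) = i" by auto
    show "s i > 0" using Spos[OF i] S0[of "a - 1 - i"] by (simp add: s_def)
    show "s (a - 1 - i) = s i" unfolding s_def i'(2) by simp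
    show "coupling a path_rel t s i = (t - k) * (t\<^sup>2 - 1) * s i"
      unfolding s_def[abs_def] coupling_add coupling_path_reverse[OF i] eigP[OF i] eigP[OF i'(1)]
      by (simp add: algebra_simps)
  qed (use tk m2 in auto)
qed

section \<open>From a small spectral radius to the clique path\<close>

lemma card_le_independence_number:
  assumes "independent_set n E S"
  shows "card S \<le> independence_number n E"
proof -
  have "{card S |S. independent_set n E S} \<subseteq> card ` Pow {0..<n}"
    by (auto simp: independent_set_def)
  then have "finite {card S |S. independent_set n E S}" by (rule finite_subset) simp
  then show ?thesis unfolding independence_number_def using assms by (intro Max_ge) auto
qed

text \<open>The all-ones vector as test vector: the average degree is at most the spectral
  radius.\<close>

lemma edge_count_le_spectral_radius:
  assumes "n > 0" "simple_graph n E"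
  shows "real (edge_count E {..<n} {..<n}) \<le> graph_spectral_radius n E * n"
proof -
  have "real (edge_count E {..<n} {..<n}) = quadratic_form n (adj E) (\<lambda>_. 1)"
    by (simp add: edge_count_def quadratic_form_def adj_def if_distrib[of real] cong: if_cong)
  also have "\<dots> \<le> graph_spectral_radius n E * sq_norm_upto n (\<lambda>_. 1)"
    by (rule graph_spectral_radius_ge_Rayleigh[OF assms])
  finally show ?thesis by (simp add: sq_norm_upto_def)
qed

lemma clique_blocks_of_spectral_radius_small:
  assumes G: "simple_graph n E" and n: "n = k * a" and a: "a > 0" and k: "2 * a + 2 < k"
    and ind: "independence_number n E = a"
    and small: "graph_spectral_radius n E \<le> t - 1" and t: "t \<ge> k" "(t - k) * (t - 1) \<le> 2"
  obtains c where "clique_blocks n k a E c"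
proof -
  have n0: "n > 0" using n a k by simp
  define d where "d = t - k"
  have d: "d \<ge> 0" "t = k + d" using t by (auto simp: d_def)
  have "d * (real k - 1) \<le> d * (t - 1)" using t d by (intro mult_left_mono) auto
  then have dk: "d * (real k - 1) \<le> 2" using t(2) by (simp add: d_def)
  \<comment> \<open>Uses \<open>a < k - 1\<close>. Writing
    \<open>(t - 1) * n = n * (k - 1) + a * d * (k - 1) + d * a\<close>, the last two terms stay
    below \<open>2 * a + 2\<close>.\<close>
  have da: "d * a < 2"
  proof (cases "d = 0")
    case False
    then have "d * a < d * (real k - 1)" using d k by (intro mult_strict_left_mono) auto
    then show ?thesis using dk by simp
  qed simp
  have "real (edge_count E {..<n} {..<n}) \<le> (t - 1) * n"
    using edge_count_le_spectral_radius[OF n0 G] small by (meson mult_right_mono of_nat_0_le_iff order_trans)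
  also have "\<dots> = n * (real k - 1) + a * (d * (real k - 1)) + d * a"
    unfolding n d(2) by (simp add: algebra_simps)
  also have "\<dots> < n * (real k - 1) + a * 2 + 2"
    using mult_left_mono[OF dk, of "real a"] da by simp
  also have "\<dots> = real (n * (k - 1) + 2 * a + 2)" using k by (simp add: of_nat_diff)
  finally have few: "edge_count E {..<n} {..<n} < n * (k - 1) + 2 * a + 2" by (simp only: of_nat_less_iff)
  have "card S \<le> a" if "independent_set n E S" for S
    using card_le_independence_number[OF that] ind by simp
  then obtain c where c: "\<And>v. v < n \<Longrightarrow> c v < a"
    and cl: "\<And>u v. u < n \<Longrightarrow> v < n \<Longrightarrow> u \<noteq> v \<Longrightarrow> c u = c v \<Longrightarrow> E u v"
    using clique_partition_of_few_edges[OF G n _ few k] by blast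
  have d1: "d < 1"
  proof (rule ccontr)
    assume "\<not> d < 1"
    then have "1 * (real k - 1) \<le> d * (real k - 1)" using k by (intro mult_right_mono) auto
    then have "real k - 1 \<le> 2" using dk by simp
    then show False using k a by simp
  qed
  define B where "B i = {v. v < n \<and> c v = i}" for i
  \<comment> \<open>A clique on \<open>k + 1\<close> vertices would force a spectral radius of at
    least \<open>k\<close>, which exceeds \<open>t - 1\<close> because \<open>d < 1\<close>. As the
    sizes average \<open>k\<close>, they are then all equal to \<open>k\<close>.\<close>
  have le: "card (B i) \<le> k" for i
  proof (rule ccontr)
    assume "\<not> card (B i) \<le> k"
    then have big: "card (B i) \<ge> k + 1" by simp
    then have "B i \<noteq> {}" by auto
    then have "real (card (B i)) - 1 \<le> graph_spectral_radius n E"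
      by (intro graph_spectral_radius_ge_clique[OF G]) (auto simp: B_def intro: cl)
    then show False using big small d d1 by linarith
  qed
  have total: "(\<Sum>i<a. card (B i)) = n"
  proof -
    have "(\<Sum>i<a. \<Sum>v\<in>{v\<in>{..<n}. c v = i}. 1) = (\<Sum>v<n. 1::nat)"
      using c by (intro sum.group) auto
    then show ?thesis by (simp add: B_def)
  qed
  have eq: "card (B i) = k" if i: "i < a" for i
  proof (rule ccontr)
    assume "card (B i) \<noteq> k"
    then have "card (B i) < k" using le[of i] by simp
    then have "(\<Sum>i<a. card (B i)) < (\<Sum>i<a. k)"
      using le i by (intro sum_strict_mono_ex1) auto
    then show False using total n by (simp add: mult.commute)
  qed
  have "clique_blocks n k a E c"
    by unfold_locales (use G c cl eq in \<open>auto simp: B_def\<close>)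
  then show thesis by (rule that)
qed

lemma graph_iso_of_spectral_radius_le:
  assumes G: "simple_graph n E" and con: "connected_graph n E" and n: "n = k * a" and a: "a > 0"
    and k: "2 * a + 2 < k" and ind: "independence_number n E = a"
    and le: "graph_spectral_radius n E \<le> graph_spectral_radius n (clique_path k a)"
  shows "graph_iso n E (clique_path k a)"
proof -
  have n0: "n > 0" and k2: "k \<ge> 2" and k0: "k > 0" using n a k by auto
  define t where "t = graph_spectral_radius (k * a) (clique_path k a) + 1"
  define m where "m = (t - k) * (t\<^sup>2 - 1)"
  obtain s where s: "\<And>i. i < a \<Longrightarrow> s i > 0" "\<And>i. i < a \<Longrightarrow> s (a - 1 - i) = s i"
    and eig: "\<And>i. i < a \<Longrightarrow> coupling a path_rel t s i = m * s i"
    and t: "t \<ge> k" "(t - k) * (t - 1) \<le> 2"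
    unfolding m_def using clique_path_eigensystem[OF k2 a t_def] by metis
  have t1: "t > 1" "t > 0" using t k by auto
  have m2: "m \<le> 2 + 2 * t"
    by (rule coupling_eigenvalue_path_le[OF a t1(2) s(1) eig])
  have small: "graph_spectral_radius n E \<le> t - 1" using le n by (simp add: t_def)
  obtain c where "clique_blocks n k a E c"
    using clique_blocks_of_spectral_radius_small[OF G n a k ind small t] by blast
  then interpret H: clique_blocks n k a E c .
  obtain f where f: "bij_betw f {..<a} {..<a}"
    and low: "\<And>j. 0 < j \<Longrightarrow> j < a \<Longrightarrow> \<exists>i\<le>j - 2. H.quotient (f i) (f j)"
    using spread_ordering[OF H.cut_connected_quotient[OF con k0] H.quotient_sym] by blast
  \<comment> \<open>Renaming the colours by the inverse of \<open>f\<close> turns the spread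
    ordering into the natural order of block numbers.\<close>
  define f' where "f' = inv_into {..<a} f"
  have f': "bij_betw f' {..<a} {..<a}" unfolding f'_def by (rule bij_betw_inv_into[OF f])
  have f'f: "f' (f i) = i" if "i < a" for i
    using bij_betw_inv_into_left[OF f] that by (simp add: f'_def)
  have fa: "f i < a" if "i < a" for i using bij_betwE[OF f] that by blast
  interpret H1: clique_blocks n k a E "f' \<circ> c" by (rule H.relabel[OF f'])
  have q1: "H1.quotient i j = H.quotient (f i) (f j)" if "i < a" "j < a" for i j
    using H.quotient_relabel[OF f' fa[OF that(1)] fa[OF that(2)]] f'f that by simp
  define z where "z = s \<circ> zigzag a"
  have zpos: "z i > 0" if "i < a" for i using s(1)[OF zigzag_less[OF that]] by (simp add: z_def)
  have zdec: "z j \<le> z i" if "i \<le> j" "j < a" for i j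
    unfolding z_def comp_def by (rule zigzag_decreasing[OF t1(2) m2 s eig that])
  have zeig: "coupling a zigzag_rel t z i = m * z i" if "i < a" for i
    using coupling_relabel[of "zigzag a" a path_rel zigzag_rel i t s, OF bij_zigzag path_rel_zigzag that] eig[OF zigzag_less[OF that]]
    by (simp add: z_def)
  \<comment> \<open>Any other quotient has a coupling eigenvalue \<open>r > m\<close>; lifting its
    eigenvector pushes the spectral radius above \<open>t - 1\<close>.\<close>
  have Kz: "H1.quotient i j = zigzag_rel i j" if ij: "i < a" "j < a" for i j
  proof (rule ccontr)
    assume ne: "H1.quotient i j \<noteq> zigzag_rel i j"
    have low1: "\<exists>i\<le>j - 2. H1.quotient i j" if j: "0 < j" "j < a" for j
    proof -
      obtain i where i: "i \<le> j - 2" "H.quotient (f i) (f j)" using low[OF j] by blast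
      then have "i < a" using j by simp
      then show ?thesis using i q1 j by blast
    qed
    obtain r x where r: "r > m" and x: "\<And>i. x i \<ge> 0" "\<exists>i<a. x i > 0"
      "\<And>i. i < a \<Longrightarrow> coupling a H1.quotient t x i = r * x i"
      using coupling_subsolution_of_not_zigzag[OF H1.quotient_sym H1.quotient_irrefl t1(2) low1 zpos zdec zeig ij ne]
      by metis
    obtain l where l: "l < a" "x l > 0" using x(2) by blast
    have "graph_spectral_radius n E > t - 1"
    proof (rule H1.spectral_radius_gt_of_strict_coupling[where s = x and i = l, OF n0 k0 t1(1) x(1) _ l])
      show "(t - k) * (t\<^sup>2 - 1) * x i \<le> coupling a H1.quotient t x i" if "i < a" for i
        unfolding x(3)[OF that] m_def[symmetric] using r x(1) by (intro mult_right_mono) auto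
      show "(t - k) * (t\<^sup>2 - 1) * x l < coupling a H1.quotient t x l"
        unfolding x(3)[OF l(1)] m_def[symmetric] using r l(2) by simp
    qed
    then show False using small by simp
  qed
  interpret H2: clique_blocks n k a E "zigzag a \<circ> (f' \<circ> c)" by (rule H1.relabel[OF bij_zigzag])
  have Kp: "H2.quotient i j = path_rel i j" if ij: "i < a" "j < a" for i j
  proof -
    obtain i' j' where ij': "i' < a" "i = zigzag a i'" "j' < a" "j = zigzag a j'"
      using ij bij_betw_imp_surj_on[OF bij_zigzag, of a] by (metis imageE lessThan_iff)
    then show ?thesis using H1.quotient_relabel[OF bij_zigzag ij'(1,3)] Kz path_rel_zigzag by simp
  qed
  \<comment> \<open>Once the quotient is the path, \<open>s\<close> itself can be lifted, and the
    bound on the spectral radius rules out shared attachment vertices and extra cross edges.\<close>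
  have "coupling a H2.quotient t s i \<ge> (t - k) * (t\<^sup>2 - 1) * s i" if "i < a" for i
    using coupling_cong[of a H2.quotient i path_rel t s] Kp[OF that] eig[OF that] by (simp add: m_def)
  then obtain p where "H2.exact_attachment p"
    using H2.exact_attachment_of_spectral_radius_le[where s = s, OF n0 k0 t1(1) s(1) _ small] by blast
  then show ?thesis by (rule H2.graph_iso_clique_path[OF n k2 _ Kp])
qed

theorem theorem1p2:
  fixes \<alpha> k n :: nat and E :: "nat \<Rightarrow> nat \<Rightarrow> bool"
  assumes "\<alpha> \<ge> 1" and "k \<ge> 1"
    and "real k > (17 * real \<alpha> + 15) / 8"
    and "n = k * \<alpha>"
    and "simple_graph n E" and "connected_graph n E"
    and "independence_number n E = \<alpha>"
  shows "graph_spectral_radius n E \<ge> graph_spectral_radius n (clique_path k \<alpha>)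
    \<and> (graph_spectral_radius n E = graph_spectral_radius n (clique_path k \<alpha>)
         \<longleftrightarrow> graph_iso n E (clique_path k \<alpha>))"
proof -
  \<comment> \<open>The hypothesis enters through \<open>(17 * \<alpha> + 15) / 8 = 2 * \<alpha> + 2
    + (\<alpha> - 1) / 8\<close> and \<open>\<alpha> \<ge> 1\<close>.\<close>
  have k: "2 * \<alpha> + 2 < k" and n: "n > 0" using assms(1-4) by auto
  \<comment> \<open>This one implication suffices: a strictly smaller spectral radius would also
    yield an isomorphism, and hence equality.\<close>
  have "graph_iso n E (clique_path k \<alpha>)"
    if "graph_spectral_radius n E \<le> graph_spectral_radius n (clique_path k \<alpha>)"
    using graph_iso_of_spectral_radius_le[OF assms(5,6,4) _ k assms(7) that] assms(1) by simp
  moreover have "graph_spectral_radius n E = graph_spectral_radius n (clique_path k \<alpha>)"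
    if "graph_iso n E (clique_path k \<alpha>)"
    using graph_spectral_radius_iso[OF n assms(5) _ that] simple_graph_clique_path assms(4) by simp
  ultimately show ?thesis by fastforce
qed

end
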